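(* There is an algorithm that, given a connected block graph $G$ with $n$ vertices and $m$ edges, computes $\mathrm{src}(G)$ in $O(n+m)$ time.
   Context: All graphs are finite, simple, undirected and connected. A block of $G$ is a maximal biconnected subgraph (a bridge edge $K_2$ counts as a block). A block graph is a graph in which every block is a clique. Given a (not necessarily proper) edge-coloring of $G$, a path is rainbow if no two of its edges have the same color. An edge-colored graph is strongly rainbow-connected if between every pair of vertices there is a shortest path that is rainbow. The strong rainbow connection number $\mathrm{src}(G)$ is the minimum number of colors in an edge-coloring making $G$ strongly rainbow-connected. *)

theory Defs
  imports Main
begin

section \<open>Graphs and strong rainbow connection\<close>

definition simple_graph :: "'a set \<Rightarrow> 'a set set \<Rightarrow> bool" where
  "simple_graph V E \<longleftrightarrow> finite V \<and> (\<forall>e\<in>E. e \<subseteq> V \<and> card e = 2)"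

definition path_between :: "'a set \<Rightarrow> 'a set set \<Rightarrow> 'a \<Rightarrow> 'a \<Rightarrow> 'a list \<Rightarrow> bool" where
  "path_between V E u v p \<longleftrightarrow>
     p \<noteq> [] \<and> hd p = u \<and> last p = v \<and> distinct p \<and> set p \<subseteq> V \<and>
     successively (\<lambda>x y. {x, y} \<in> E) p"

definition path_edges :: "'a list \<Rightarrow> 'a set list" where
  "path_edges p = map2 (\<lambda>x y. {x, y}) p (tl p)"

definition connected_graph :: "'a set \<Rightarrow> 'a set set \<Rightarrow> bool" where
  "connected_graph V E \<longleftrightarrow>
     simple_graph V E \<and> V \<noteq> {} \<and> (\<forall>u\<in>V. \<forall>v\<in>V. \<exists>p. path_between V E u v p)"

definition subgraph :: "'a set \<Rightarrow> 'a set set \<Rightarrow> 'a set \<Rightarrow> 'a set set \<Rightarrow> bool" where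
  "subgraph W F V E \<longleftrightarrow> simple_graph W F \<and> W \<subseteq> V \<and> F \<subseteq> E"

text \<open>
  The complete graph on two vertices is biconnected in this sense: deleting a vertex leaves
  a single vertex, which is connected.
\<close>

definition biconnected :: "'a set \<Rightarrow> 'a set set \<Rightarrow> bool" where
  "biconnected V E \<longleftrightarrow>
     2 \<le> card V \<and> connected_graph V E \<and>
     (\<forall>v\<in>V. connected_graph (V - {v}) {e \<in> E. v \<notin> e})"

definition graph_block :: "'a set \<Rightarrow> 'a set set \<Rightarrow> 'a set \<Rightarrow> 'a set set \<Rightarrow> bool" where
  "graph_block V E W F \<longleftrightarrow>
     subgraph W F V E \<and> biconnected W F \<and>
     (\<forall>W' F'. subgraph W' F' V E \<and> biconnected W' F' \<and> subgraph W F W' F' \<longrightarrow>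
        W' = W \<and> F' = F)"

definition complete_graph :: "'a set \<Rightarrow> 'a set set \<Rightarrow> bool" where
  "complete_graph V E \<longleftrightarrow> (\<forall>u\<in>V. \<forall>v\<in>V. u \<noteq> v \<longrightarrow> {u, v} \<in> E)"

definition block_graph :: "'a set \<Rightarrow> 'a set set \<Rightarrow> bool" where
  "block_graph V E \<longleftrightarrow>
     simple_graph V E \<and> (\<forall>W F. graph_block V E W F \<longrightarrow> complete_graph W F)"

definition shortest_path :: "'a set \<Rightarrow> 'a set set \<Rightarrow> 'a \<Rightarrow> 'a \<Rightarrow> 'a list \<Rightarrow> bool" where
  "shortest_path V E u v p \<longleftrightarrow>
     path_between V E u v p \<and> (\<forall>q. path_between V E u v q \<longrightarrow> length p \<le> length q)"

definition rainbow_path :: "('a set \<Rightarrow> 'c) \<Rightarrow> 'a list \<Rightarrow> bool" where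
  "rainbow_path c p \<longleftrightarrow> distinct (map c (path_edges p))"

definition strongly_rainbow_connected ::
    "'a set \<Rightarrow> 'a set set \<Rightarrow> ('a set \<Rightarrow> 'c) \<Rightarrow> bool" where
  "strongly_rainbow_connected V E c \<longleftrightarrow>
     (\<forall>u\<in>V. \<forall>v\<in>V. \<exists>p. shortest_path V E u v p \<and> rainbow_path c p)"

definition strong_rainbow_connection_number :: "'a set \<Rightarrow> 'a set set \<Rightarrow> nat" where
  "strong_rainbow_connection_number V E =
     (LEAST k. \<exists>c :: 'a set \<Rightarrow> nat. strongly_rainbow_connected V E c \<and> card (c ` E) = k)"


section \<open>A word RAM\<close>

text \<open>
  The machine has registers and a random-access memory, both indexed by and containing
  natural numbers; a program only mentions finitely many registers. Control flow
  is structured rather than by jumps, which changes running times by at most a constant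
  factor depending on the program.
\<close>

datatype operand = Imm nat | Reg nat

datatype test = Less operand operand | Equal operand operand

datatype program =
    Skip
  | Move nat operand
  | Add nat operand operand
  | Sub nat operand operand
  | Load nat operand
  | Store operand operand
  | Sequence program program
  | Branch test program program
  | Loop test program

type_synonym ram_state = "(nat \<Rightarrow> nat) \<times> (nat \<Rightarrow> nat)"

fun operand_val :: "(nat \<Rightarrow> nat) \<Rightarrow> operand \<Rightarrow> nat" where
  "operand_val R (Imm k) = k"
| "operand_val R (Reg r) = R r"

fun test_val :: "(nat \<Rightarrow> nat) \<Rightarrow> test \<Rightarrow> bool" where
  "test_val R (Less a b) \<longleftrightarrow> operand_val R a < operand_val R b"
| "test_val R (Equal a b) \<longleftrightarrow> operand_val R a = operand_val R b"

text \<open>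
  \<open>ram_exec W P s t s'\<close>: started in \<open>s\<close>, the program \<open>P\<close> halts in \<open>s'\<close> after
  exactly \<open>t\<close> unit-cost steps, and every value written and every address used is less than
  \<open>W\<close>, i.e. fits into a machine word. An instruction that would exceed \<open>W\<close> is stuck.
  Subtraction is truncated at zero.
\<close>

inductive ram_exec :: "nat \<Rightarrow> program \<Rightarrow> ram_state \<Rightarrow> nat \<Rightarrow> ram_state \<Rightarrow> bool"
  for W :: nat where
  Skip: "ram_exec W Skip s 1 s"
| Move: "operand_val R a < W \<Longrightarrow>
    ram_exec W (Move r a) (R, M) 1 (R(r := operand_val R a), M)"
| Add: "operand_val R a + operand_val R b < W \<Longrightarrow>
    ram_exec W (Add r a b) (R, M) 1 (R(r := operand_val R a + operand_val R b), M)"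
| Sub: "operand_val R a - operand_val R b < W \<Longrightarrow>
    ram_exec W (Sub r a b) (R, M) 1 (R(r := operand_val R a - operand_val R b), M)"
| Load: "operand_val R a < W \<Longrightarrow> M (operand_val R a) < W \<Longrightarrow>
    ram_exec W (Load r a) (R, M) 1 (R(r := M (operand_val R a)), M)"
| Store: "operand_val R a < W \<Longrightarrow> operand_val R b < W \<Longrightarrow>
    ram_exec W (Store a b) (R, M) 1 (R, M(operand_val R a := operand_val R b))"
| Sequence: "ram_exec W P s t s' \<Longrightarrow> ram_exec W Q s' t' s'' \<Longrightarrow>
    ram_exec W (Sequence P Q) s (t + t') s''"
| BranchTrue: "test_val (fst s) b \<Longrightarrow> ram_exec W P s t s' \<Longrightarrow>
    ram_exec W (Branch b P Q) s (1 + t) s'"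
| BranchFalse: "\<not> test_val (fst s) b \<Longrightarrow> ram_exec W Q s t s' \<Longrightarrow>
    ram_exec W (Branch b P Q) s (1 + t) s'"
| LoopExit: "\<not> test_val (fst s) b \<Longrightarrow> ram_exec W (Loop b P) s 1 s"
| LoopStep: "test_val (fst s) b \<Longrightarrow> ram_exec W P s t s' \<Longrightarrow>
    ram_exec W (Loop b P) s' t' s'' \<Longrightarrow> ram_exec W (Loop b P) s (1 + t + t') s''"

inductive_cases ram_exec_cases:
  "ram_exec W Skip s t s'"
  "ram_exec W (Move r a) s t s'"
  "ram_exec W (Add r a b) s t s'"
  "ram_exec W (Sub r a b) s t s'"
  "ram_exec W (Load r a) s t s'"
  "ram_exec W (Store a b) s t s'"
  "ram_exec W (Sequence P Q) s t s'"
  "ram_exec W (Branch c P Q) s t s'"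
  "ram_exec W (Loop c P) s t s'"

lemma ram_exec_deterministic:
  "ram_exec W P s t s' \<Longrightarrow> ram_exec W P s u s'' \<Longrightarrow> u = t \<and> s'' = s'"
proof (induction arbitrary: u s'' rule: ram_exec.induct)
  case (Sequence P s t s' Q t' s2)
  from Sequence.prems obtain t1 s1 t2
    where "ram_exec W P s t1 s1" "ram_exec W Q s1 t2 s''" "u = t1 + t2"
    by (rule ram_exec_cases(7))
  with Sequence.IH show ?case by metis
next
  case (BranchTrue s b P t s' Q)
  from BranchTrue.prems BranchTrue.hyps(1) obtain t1
    where "ram_exec W P s t1 s''" "u = 1 + t1"
    by cases auto
  with BranchTrue.IH show ?case by metis
next
  case (BranchFalse s b Q t s' P)
  from BranchFalse.prems BranchFalse.hyps(1) obtain t1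
    where "ram_exec W Q s t1 s''" "u = 1 + t1"
    by cases auto
  with BranchFalse.IH show ?case by metis
next
  case (LoopExit s b P)
  from LoopExit.prems LoopExit.hyps show ?case by cases auto
next
  case (LoopStep s b P t s' t' s2)
  from LoopStep.prems LoopStep.hyps(1) obtain t1 s1 t2
    where "ram_exec W P s t1 s1" "ram_exec W (Loop b P) s1 t2 s''" "u = 1 + t1 + t2"
    by cases auto
  with LoopStep.IH show ?case by metis
qed (erule ram_exec_cases(1-6), simp)+

text \<open>
  Graphs on \<open>{..<n}\<close> are given by adjacency lists, in arbitrary order. The input occupies
  an initial segment of memory: the numbers of vertices and edges, then the \<open>n + 1\<close>
  addresses at which the list of each vertex starts (the last one marking the end of the input),
  then the lists themselves. All other cells and all registers are initially zero.
\<close>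

definition adjacency_lists :: "nat \<Rightarrow> nat set set \<Rightarrow> nat list list \<Rightarrow> bool" where
  "adjacency_lists n E adj \<longleftrightarrow>
     length adj = n \<and> (\<forall>i<n. distinct (adj ! i) \<and> set (adj ! i) = {j. {i, j} \<in> E})"

definition graph_encoding :: "nat \<Rightarrow> nat \<Rightarrow> nat list list \<Rightarrow> nat list" where
  "graph_encoding n m adj =
     [n, m] @ map (\<lambda>i. n + 3 + length (concat (take i adj))) [0..<n + 1] @ concat adj"

definition input_state :: "nat list \<Rightarrow> ram_state" where
  "input_state xs = ((\<lambda>_. 0), (\<lambda>i. if i < length xs then xs ! i else 0))"

definition output_value :: "ram_state \<Rightarrow> nat" where
  "output_value s = fst s 0"

end

theory Submission
  imports Defs
begin

text \<open>
  The strong rainbow connection number of a connected block graph is the number of blocks with at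
  most two cut vertices. Each such block has an edge through all its cut vertices, and any two of these
  edges lie on a common (unique) shortest path, which gives the lower bound. Conversely, let every such
  block be monochromatic with a colour of its own. An edge of a block with at least three cut
  vertices misses a cut vertex \<open>w\<close>; it gets the colour of a block with at most two cut vertices
  that lies behind \<open>w\<close>, which no shortest path through the edge reaches.

  For the computation, root the graph at 0 by a graph search. In each block all vertices but one
  have the remaining one as their parent, so that blocks correspond to classes of adjacent siblings.
  A vertex other than the root is a cut vertex iff it has a child, and the root is one iff it is the
  parent of at least two classes.
\<close>

section \<open>Cliques in block graphs\<close>

text \<open>The hypothesis on blocks enters only through \<open>cycle_clique\<close>: a cycle is
  biconnected, so its vertices are pairwise adjacent. For a search order this yields two local
  facts: an edge joins a vertex to its parent or to a sibling, and adjacency of siblings is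
  transitive. The locale \<open>clique_tree\<close> keeps these facts and the parent function, so
  the combinatorics does not depend on how the order was found.

  Distances are never computed. Shortest paths are replaced by paths without a shortcut past a
  single vertex (\<open>induced\<close>), and \<open>branch a b\<close> collects what may follow a
  step from \<open>a\<close> to \<open>b\<close>. Different steps from \<open>a\<close> have
  disjoint branches, and branches shrink along an induced path. Hence two edges lie on a common
  shortest path as soon as each lies in the branch that points towards it.

  The delicate point of the colouring is that two edges may both borrow the colour of the same block
  \<open>D\<close>. If they were on one shortest path, the two branches pointing at each other would
  cover \<open>V\<close> and leave no room for \<open>D\<close>, which meets neither.\<close>

definition edge_rel :: "'a set \<Rightarrow> 'a set set \<Rightarrow> ('a \<times> 'a) set" where
  "edge_rel V E = {(x, y). x \<in> V \<and> y \<in> V \<and> {x, y} \<in> E}"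

lemma edge_rel_sym: "(x, y) \<in> (edge_rel V E)\<^sup>* \<Longrightarrow> (y, x) \<in> (edge_rel V E)\<^sup>*"
proof -
  have "sym (edge_rel V E)"
    by (auto simp: edge_rel_def sym_def insert_commute)
  then show "(x, y) \<in> (edge_rel V E)\<^sup>* \<Longrightarrow> (y, x) \<in> (edge_rel V E)\<^sup>*"
    by (meson sym_rtrancl symD)
qed

lemma edge_rel_mono: "V \<subseteq> V' \<Longrightarrow> (x, y) \<in> (edge_rel V E)\<^sup>* \<Longrightarrow> (x, y) \<in> (edge_rel V' E)\<^sup>*"
  by (rule subsetD[OF rtrancl_mono]) (auto simp: edge_rel_def)

text \<open>Walks concatenate freely, paths do not: when the next vertex is already on the path, the
  path is cut back to it.\<close>

lemma path_between_if_edge_rel: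
  assumes "(u, v) \<in> (edge_rel V E)\<^sup>*" "u \<in> V"
  shows "\<exists>p. path_between V E u v p"
  using assms
proof (induction rule: rtrancl_induct)
  case base
  then have "path_between V E u u [u]" by (simp add: path_between_def)
  then show ?case ..
next
  case (step y z)
  then obtain p where p: "path_between V E u y p" by blast
  from step have yz: "z \<in> V" "{y, z} \<in> E" by (auto simp: edge_rel_def)
  show ?case
  proof (cases "z \<in> set p")
    case True
    then obtain xs ys where "p = xs @ z # ys" by (meson split_list)
    then have "path_between V E u z (xs @ [z])"
      using p by (auto simp: path_between_def successively_append_iff hd_append split: if_splits)
    then show ?thesis ..
  next
    case False
    then have "path_between V E u z (p @ [z])"
      using p yz by (auto simp: path_between_def successively_append_iff)
    then show ?thesis ..
  qed
qed

lemma successively_edge_rel: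
  assumes "successively (\<lambda>x y. {x, y} \<in> E) p" "set p \<subseteq> W" "y \<in> set p"
  shows "(hd p, y) \<in> (edge_rel W E)\<^sup>*"
  using assms
proof (induction p)
  case Nil
  then show ?case by simp
next
  case (Cons a p)
  show ?case
  proof (cases "y = a")
    case False
    then have y: "y \<in> set p" using Cons.prems by simp
    then obtain b q where p: "p = b # q" by (cases p) auto
    have "(b, y) \<in> (edge_rel W E)\<^sup>*" using Cons y p by auto
    moreover have "(a, b) \<in> edge_rel W E" using Cons.prems p by (auto simp: edge_rel_def)
    ultimately show ?thesis by (simp add: converse_rtrancl_into_rtrancl)
  qed simp
qed

text \<open>Reachability is symmetric and transitive, so routes to one common vertex
  \<open>w\<close> connect everything.\<close>

lemma connected_graph_hub:
  assumes "simple_graph V E" "W \<subseteq> V" "w \<in> W"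
    and hub: "\<And>v. v \<in> W \<Longrightarrow> (v, w) \<in> (edge_rel W E)\<^sup>*"
  shows "connected_graph W {e \<in> E. e \<subseteq> W}"
proof -
  have "edge_rel W E = edge_rel W {e \<in> E. e \<subseteq> W}" by (auto simp: edge_rel_def)
  then have "\<exists>p. path_between W {e \<in> E. e \<subseteq> W} u v p" if "u \<in> W" "v \<in> W" for u v
    using that hub path_between_if_edge_rel edge_rel_sym by (metis rtrancl_trans)
  then show ?thesis
    using assms by (auto simp: connected_graph_def simple_graph_def intro: finite_subset)
qed

lemma subgraph_trans: "subgraph A F B G \<Longrightarrow> subgraph B G C H \<Longrightarrow> subgraph A F C H"
  by (auto simp: subgraph_def)

lemma simple_graph_finite_edges: "simple_graph V E \<Longrightarrow> finite E"
  unfolding simple_graph_def by (meson Pow_iff finite_Pow_iff finite_subset subsetI)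

text \<open>Among the biconnected subgraphs that contain the given one, one with the largest sum of
  vertex and edge counts is maximal, because both counts can only grow.\<close>

lemma block_exists:
  assumes G: "simple_graph V E" and W: "subgraph W F V E" "biconnected W F"
  shows "\<exists>W' F'. graph_block V E W' F' \<and> subgraph W F W' F'"
proof -
  define S where "S = {(A, B). subgraph A B V E \<and> biconnected A B \<and> subgraph W F A B}"
  have fin: "finite V" "finite E"
    using G simple_graph_finite_edges by (auto simp: simple_graph_def)
  let ?f = "\<lambda>y. card (fst y) + card (snd y)"
  have "(W, F) \<in> S"
    using W by (simp add: S_def subgraph_def)
  moreover have "?f y < card V + card E + 1" if "y \<in> S" for y
  proof -
    have "card (fst y) \<le> card V" "card (snd y) \<le> card E"
      using that fin by (auto simp: S_def subgraph_def intro: card_mono)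
    then show ?thesis by simp
  qed
  ultimately obtain z where z: "z \<in> S" "\<And>y. y \<in> S \<Longrightarrow> ?f y \<le> ?f z"
    using Lattices_Big.ex_has_greatest_nat[of "\<lambda>y. y \<in> S" "(W, F)" ?f] by blast
  obtain A B where AB: "z = (A, B)" by (cases z)
  have "W' = A \<and> F' = B" if "subgraph W' F' V E" "biconnected W' F'" "subgraph A B W' F'" for W' F'
  proof -
    have "(W', F') \<in> S"
      using that z(1) AB by (auto simp: S_def intro: subgraph_trans)
    then have le: "card W' + card F' \<le> card A + card B" using z(2) AB by fastforce
    have "A \<subseteq> W'" "B \<subseteq> F'" using that(3) by (auto simp: subgraph_def)
    moreover have "finite W'" "finite F'"
      using that(1) fin by (auto simp: subgraph_def intro: finite_subset)
    ultimately have "card A \<le> card W'" "card B \<le> card F'" by (auto intro: card_mono)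
    then have "card W' \<le> card A" "card F' \<le> card B" using le by linarith+
    then show ?thesis
      using \<open>A \<subseteq> W'\<close> \<open>B \<subseteq> F'\<close> \<open>finite W'\<close> \<open>finite F'\<close> by (metis card_seteq)
  qed
  then show ?thesis
    using z(1) AB by (auto simp: S_def graph_block_def)
qed

lemma biconnected_clique:
  assumes "block_graph V E" "subgraph W F V E" "biconnected W F" "u \<in> W" "v \<in> W" "u \<noteq> v"
  shows "{u, v} \<in> E"
proof -
  obtain W' F' where W': "graph_block V E W' F'" "subgraph W F W' F'"
    using block_exists assms by (metis block_graph_def)
  have "complete_graph W' F'" "F' \<subseteq> E" "u \<in> W'" "v \<in> W'"
    using assms W' by (auto simp: block_graph_def graph_block_def subgraph_def)
  then show ?thesis
    using assms(6) by (auto simp: complete_graph_def)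
qed

text \<open>\<open>p\<close> and \<open>w\<close> form a cycle. Deleting \<open>w\<close> leaves the
  path, and deleting a vertex of \<open>p\<close> leaves at most two pieces, both still attached to
  \<open>w\<close>. So the subgraph induced on the cycle is biconnected and lies in a
  clique.\<close>

lemma cycle_clique:
  assumes bg: "block_graph V E" and p: "path_between V E u x p" and w: "w \<notin> set p" "w \<in> V"
    and ux: "u \<noteq> x" "{u, w} \<in> E" "{x, w} \<in> E"
    and ab: "a \<in> insert w (set p)" "b \<in> insert w (set p)" "a \<noteq> b"
  shows "{a, b} \<in> E"
proof -
  define W where "W = insert w (set p)"
  have sg: "simple_graph V E" using bg by (simp add: block_graph_def)
  have WV: "W \<subseteq> V" using p w by (auto simp: W_def path_between_def)
  have pp: "successively (\<lambda>x y. {x, y} \<in> E) p" "hd p = u" "last p = x" "p \<noteq> []" "distinct p"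
    using p by (auto simp: path_between_def)
  have conn_p: "(u, y) \<in> (edge_rel (set p) E)\<^sup>*" if "y \<in> set p" for y
    using successively_edge_rel[OF pp(1) subset_refl that] pp by simp
  have u: "u \<in> set p" using pp by auto
  have sub: "connected_graph (W - {v}) {e \<in> E. e \<subseteq> W - {v}}" if v: "v \<in> W" for v
  proof (cases "v = w")
    case True
    then have "W - {v} = set p" using w by (auto simp: W_def)
    moreover have "connected_graph (set p) {e \<in> E. e \<subseteq> set p}"
      by (rule connected_graph_hub[OF sg _ u edge_rel_sym[OF conn_p]]) (use WV in \<open>auto simp: W_def\<close>)
    ultimately show ?thesis by simp
  next
    case False
    \<comment> \<open>Unless empty, \<open>ys\<close> begins with \<open>u\<close> and
      \<open>rev zs\<close> begins with \<open>x\<close>: each piece is walked from the end that is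
      adjacent to \<open>w\<close>.\<close>
    then obtain ys zs where yz: "p = ys @ v # zs"
      using v by (auto simp: W_def dest: split_list)
    have succ: "successively (\<lambda>x y. {x, y} \<in> E) ys" "successively (\<lambda>x y. {x, y} \<in> E) (rev zs)"
      using pp(1) by (auto simp: yz successively_append_iff successively_Cons successively_rev insert_commute)
    have "(y, w) \<in> (edge_rel (W - {v}) E)\<^sup>*" if y: "y \<in> W - {v}" for y
    proof -
      consider "y = w" | "y \<in> set ys" | "y \<in> set (rev zs)"
        using y by (auto simp: W_def yz)
      then show ?thesis
      proof cases
        case 2
        have s: "set ys \<subseteq> W - {v}" using pp(5) by (auto simp: W_def yz)
        have h: "hd ys = u" using 2 pp(2) yz by (cases ys) auto
        have "(u, y) \<in> (edge_rel (W - {v}) E)\<^sup>*"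
          using successively_edge_rel[OF succ(1) s 2] h by simp
        moreover have "(u, w) \<in> edge_rel (W - {v}) E"
          using 2 h ux s False by (cases ys) (auto simp: edge_rel_def W_def)
        ultimately show ?thesis by (meson edge_rel_sym r_into_rtrancl rtrancl_trans)
      next
        case 3
        have s: "set (rev zs) \<subseteq> W - {v}" using pp(5) by (auto simp: W_def yz)
        have h: "hd (rev zs) = x" using 3 pp(3) yz by (auto simp: hd_rev simp del: last_rev)
        have "(x, y) \<in> (edge_rel (W - {v}) E)\<^sup>*"
          using successively_edge_rel[OF succ(2) s 3] h by simp
        moreover have "(x, w) \<in> edge_rel (W - {v}) E"
        proof -
          have "x \<in> set zs" using 3 h hd_in_set[of "rev zs"] by fastforce
          then have "x \<in> W - {v}" using s by auto
          then show ?thesis using ux(3) False by (simp add: edge_rel_def W_def)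
        qed
        ultimately show ?thesis by (meson edge_rel_sym r_into_rtrancl rtrancl_trans)
      qed simp
    qed
    then show ?thesis
      by (intro connected_graph_hub[OF sg, of "W - {v}" w]) (use WV False in \<open>auto simp: W_def\<close>)
  qed
  have conn: "connected_graph W {e \<in> E. e \<subseteq> W}"
  proof (rule connected_graph_hub[OF sg WV, of u])
    show "u \<in> W" using u by (simp add: W_def)
    fix v assume "v \<in> W"
    moreover have "(w, u) \<in> edge_rel W E"
      using u ux by (auto simp: edge_rel_def W_def insert_commute)
    moreover have "(y, u) \<in> (edge_rel W E)\<^sup>*" if "y \<in> set p" for y
      by (rule edge_rel_sym, rule edge_rel_mono[OF _ conn_p[OF that]]) (auto simp: W_def)
    ultimately show "(v, u) \<in> (edge_rel W E)\<^sup>*" by (auto simp: W_def)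
  qed
  have eq: "{e \<in> {e \<in> E. e \<subseteq> W}. v \<notin> e} = {e \<in> E. e \<subseteq> W - {v}}" for v by auto
  have "card {u, w} \<le> card W"
    using u by (intro card_mono) (auto simp: W_def)
  moreover have "u \<noteq> w" using u w by auto
  ultimately have "biconnected W {e \<in> E. e \<subseteq> W}"
    using conn sub unfolding biconnected_def eq by simp
  moreover have "subgraph W {e \<in> E. e \<subseteq> W} V E"
    using WV sg by (auto simp: subgraph_def simple_graph_def intro: finite_subset)
  ultimately show ?thesis
    using biconnected_clique[OF bg] ab by (simp add: W_def)
qed

section \<open>Search orders\<close>

text \<open>
  In the order in which a graph search discovers the vertices, the parent of a vertex is its
  earliest neighbour.
\<close>

locale search_order =
  fixes V :: "'a set" and E :: "'a set set" and r :: 'a and par :: "'a \<Rightarrow> 'a" and ord :: "'a \<Rightarrow> nat"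
  assumes bg: "block_graph V E"
    and root: "r \<in> V" "par r = r"
    and inj: "inj_on ord V"
    and par: "\<And>v. v \<in> V \<Longrightarrow> v \<noteq> r \<Longrightarrow> par v \<in> V \<and> {v, par v} \<in> E \<and> ord (par v) < ord v"
    and first: "\<And>v a. {v, a} \<in> E \<Longrightarrow> v \<noteq> r \<Longrightarrow> ord (par v) \<le> ord a"
begin

lemma edgeD: "{u, v} \<in> E \<Longrightarrow> u \<in> V \<and> v \<in> V \<and> u \<noteq> v"
proof -
  assume "{u, v} \<in> E"
  moreover have "\<forall>e\<in>E. e \<subseteq> V \<and> card e = 2" using bg by (simp add: block_graph_def simple_graph_def)
  ultimately have "{u, v} \<subseteq> V" "card {u, v} = 2" by blast+
  then show ?thesis by (cases "u = v") auto
qed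

lemma ord_root: "v \<in> V \<Longrightarrow> ord r \<le> ord v"
proof (induction "ord v" arbitrary: v rule: less_induct)
  case less
  show ?case
  proof (cases "v = r")
    case False
    then have "ord r \<le> ord (par v)" using less par by blast
    then show ?thesis using par[of v] less.prems False by simp
  qed simp
qed

text \<open>Passing to the parent lowers \<open>ord\<close>, so a parent chain never leaves an
  initial segment of the order.\<close>

lemma connected_below:
  "v \<in> V \<Longrightarrow> ord v < k \<Longrightarrow> (v, r) \<in> (edge_rel {x \<in> V. ord x < k} E)\<^sup>*"
proof (induction "ord v" arbitrary: v rule: less_induct)
  case less
  show ?case
  proof (cases "v = r")
    case False
    have "(par v, r) \<in> (edge_rel {x \<in> V. ord x < k} E)\<^sup>*"
      using less par[of v] False by simp
    moreover have "(v, par v) \<in> edge_rel {x \<in> V. ord x < k} E"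
      using less par[of v] False by (simp add: edge_rel_def)
    ultimately show ?thesis by (simp add: converse_rtrancl_into_rtrancl)
  qed simp
qed

text \<open>The vertices before \<open>w\<close> are connected among themselves, so some path from
  \<open>u\<close> to \<open>x\<close> avoids \<open>w\<close> and is closed to a cycle by
  \<open>w\<close>.\<close>

lemma earlier_neighbours_adjacent:
  assumes "{u, w} \<in> E" "{x, w} \<in> E" "ord u < ord w" "ord x < ord w" "u \<noteq> x"
  shows "{u, x} \<in> E"
proof -
  let ?S = "{v \<in> V. ord v < ord w}"
  have V: "u \<in> V" "x \<in> V" "w \<in> V" using assms edgeD by auto
  have "(u, r) \<in> (edge_rel ?S E)\<^sup>*" "(x, r) \<in> (edge_rel ?S E)\<^sup>*"
    using connected_below V assms by auto
  then have "(u, x) \<in> (edge_rel ?S E)\<^sup>*"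
    by (meson edge_rel_sym rtrancl_trans)
  then obtain p where p: "path_between ?S E u x p"
    using path_between_if_edge_rel[of u x ?S E] V assms(3) by blast
  then have *: "path_between V E u x p" "w \<notin> set p"
    unfolding path_between_def by blast+
  have "u \<in> set p" "x \<in> set p"
    using p hd_in_set[of p] last_in_set[of p] by (simp_all add: path_between_def)
  then show ?thesis using cycle_clique[OF bg * V(3) assms(5) assms(1,2)] assms(5) by blast
qed

lemma square_clique:
  assumes "{a, b} \<in> E" "{b, c} \<in> E" "{c, d} \<in> E" "{d, a} \<in> E" "a \<noteq> c" "b \<noteq> d"
  shows "{a, c} \<in> E"
proof -
  have "a \<in> V" "b \<in> V" "c \<in> V" "d \<in> V" "a \<noteq> b" "b \<noteq> c" "c \<noteq> d" "d \<noteq> a"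
    using edgeD[OF assms(1)] edgeD[OF assms(2)] edgeD[OF assms(3)] edgeD[OF assms(4)] by auto
  moreover from this have "path_between V E a c [a, b, c]"
    using assms by (simp add: path_between_def)
  ultimately show ?thesis
    using cycle_clique[OF bg, of a c "[a, b, c]" d a c] assms by (simp add: insert_commute)
qed

text \<open>If \<open>x = par w\<close> differs from \<open>u\<close>, then \<open>x\<close>
  precedes \<open>u\<close>, being the earliest neighbour of \<open>w\<close>, and the two are
  adjacent. If moreover \<open>y = par u\<close> differed from \<open>x\<close>, it would precede
  \<open>x\<close>, and the four-cycle \<open>y\<close>, \<open>x\<close>, \<open>w\<close>,
  \<open>u\<close> would make \<open>y\<close> a neighbour of \<open>w\<close> before
  \<open>par w\<close>.\<close>

lemma edge_cases_ordered:
  assumes e: "{u, w} \<in> E" and less: "ord u < ord w"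
  shows "w \<noteq> r \<and> (par w = u \<or> u \<noteq> r \<and> par u = par w)"
proof -
  have V: "u \<in> V" "w \<in> V" using e edgeD by auto
  have w: "w \<noteq> r" using ord_root[of u] less V by auto
  define x where "x = par w"
  have x: "x \<in> V" "{w, x} \<in> E" "ord x < ord w" using par[of w] V w by (auto simp: x_def)
  have "par u = x" "u \<noteq> r" if ne: "x \<noteq> u"
  proof -
    have "ord x \<le> ord u" using first[of w u] e w by (simp add: x_def insert_commute)
    then have xu: "ord x < ord u" using ne inj x V by (metis inj_onD le_neq_implies_less)
    then show u: "u \<noteq> r" using ord_root[of x] x by auto
    have ux: "{u, x} \<in> E"
      using earlier_neighbours_adjacent[of u w x] e x less ne by (auto simp: insert_commute)
    define y where "y = par u"
    have y: "y \<in> V" "{u, y} \<in> E" "ord y < ord u" using par[of u] V u by (auto simp: y_def)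
    have "ord y \<le> ord x" using first[OF ux u] by (simp add: y_def)
    show "par u = x"
    proof (rule ccontr)
      assume "par u \<noteq> x"
      then have yx: "y \<noteq> x" by (simp add: y_def)
      then have yx': "ord y < ord x" using \<open>ord y \<le> ord x\<close> inj x y by (metis inj_onD le_neq_implies_less)
      have "{y, x} \<in> E"
        using earlier_neighbours_adjacent[of y u x] ux y yx xu by (auto simp: insert_commute)
      then have "{y, w} \<in> E"
        using square_clique[of y x w u] e x y yx' less xu ne by (cases "y = w") (auto simp: insert_commute)
      then show False using first[of w y] w yx' by (auto simp: insert_commute x_def)
    qed
  qed
  then show ?thesis using w x_def by metis
qed

lemma edge_cases:
  assumes e: "{u, w} \<in> E"
  shows "u \<noteq> r \<and> par u = w \<or> w \<noteq> r \<and> par w = u \<or> u \<noteq> r \<and> w \<noteq> r \<and> par u = par w"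
proof -
  have "ord u \<noteq> ord w" using e edgeD[of u w] inj by (meson inj_onD)
  then have "ord u < ord w \<or> ord w < ord u" by linarith
  then show ?thesis using edge_cases_ordered[of u w] edge_cases_ordered[of w u] e
    by (auto simp: insert_commute)
qed

text \<open>The common parent completes \<open>a\<close>, \<open>b\<close>, \<open>c\<close> to a
  four-cycle in which \<open>a\<close> and \<open>c\<close> are opposite.\<close>

lemma sibling_trans:
  assumes "{a, b} \<in> E" "{b, c} \<in> E" "par a = par b" "par b = par c" "a \<noteq> r" "b \<noteq> r" "c \<noteq> r" "a \<noteq> c"
  shows "{a, c} \<in> E"
proof -
  have "a \<in> V" "b \<in> V" "c \<in> V" using assms edgeD by auto
  then have "{a, par b} \<in> E" "{par b, c} \<in> E" "b \<noteq> par b"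
    using assms par[of a] par[of b] par[of c] by (auto simp: insert_commute)
  then show ?thesis
    using square_clique[of a b c "par b"] assms by (simp add: insert_commute)
qed

end

section \<open>Rooted trees of cliques\<close>

text \<open>Here \<open>ord\<close> is a mere rank that makes parent chains end at the root; being
  the earliest neighbour is replaced by its two consequences for edges.\<close>

locale clique_tree =
  fixes V :: "'a set" and E :: "'a set set" and r :: 'a and par :: "'a \<Rightarrow> 'a" and ord :: "'a \<Rightarrow> nat"
  assumes simple: "simple_graph V E"
    and root: "r \<in> V" "par r = r"
    and par: "\<And>v. v \<in> V \<Longrightarrow> v \<noteq> r \<Longrightarrow> par v \<in> V \<and> {v, par v} \<in> E \<and> ord (par v) < ord v"
    and edge_cases: "\<And>u w. {u, w} \<in> E \<Longrightarrow>
      u \<noteq> r \<and> par u = w \<or> w \<noteq> r \<and> par w = u \<or> u \<noteq> r \<and> w \<noteq> r \<and> par u = par w"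
    and sibling_trans: "\<And>a b c. {a, b} \<in> E \<Longrightarrow> {b, c} \<in> E \<Longrightarrow> par a = par b \<Longrightarrow> par b = par c \<Longrightarrow>
      a \<noteq> r \<Longrightarrow> b \<noteq> r \<Longrightarrow> c \<noteq> r \<Longrightarrow> a \<noteq> c \<Longrightarrow> {a, c} \<in> E"
begin

lemma finite_V: "finite V"
  using simple by (simp add: simple_graph_def)

lemma finite_E: "finite E"
  using simple by (rule simple_graph_finite_edges)

lemma edge_pair: "e \<in> E \<Longrightarrow> \<exists>u v. e = {u, v} \<and> u \<in> V \<and> v \<in> V \<and> u \<noteq> v"
proof -
  assume "e \<in> E"
  then have "e \<subseteq> V" "card e = 2" using simple by (auto simp: simple_graph_def)
  then show ?thesis by (auto simp: card_2_iff)
qed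

lemma edgeD: "{u, v} \<in> E \<Longrightarrow> u \<in> V \<and> v \<in> V \<and> u \<noteq> v"
  using edge_pair[of "{u, v}"] by (auto simp: doubleton_eq_iff)

lemma edge_sym: "{u, v} \<in> E \<Longrightarrow> {v, u} \<in> E"
  by (simp add: insert_commute)

lemma par_V: "v \<in> V \<Longrightarrow> par v \<in> V"
  using par root by (cases "v = r") auto

lemma par_neq: "v \<in> V \<Longrightarrow> v \<noteq> r \<Longrightarrow> par v \<noteq> v"
  using par by force

lemma par_par_neq: "v \<in> V \<Longrightarrow> v \<noteq> r \<Longrightarrow> par (par v) \<noteq> v"
  using par[of v] par[of "par v"] root by (cases "par v = r") force+

lemma vertex_induct [consumes 1, case_names root step]:
  assumes "v \<in> V" "P r" "\<And>v. v \<in> V \<Longrightarrow> v \<noteq> r \<Longrightarrow> P (par v) \<Longrightarrow> P v"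
  shows "P v"
  using assms(1)
proof (induction "ord v" arbitrary: v rule: less_induct)
  case less
  then show ?case using assms(2,3) par[of v] by (cases "v = r") auto
qed

text \<open>The class of \<open>v\<close> is its parent block without the parent, which is the vertex of the block
  nearest to the root.\<close>

definition cls :: "'a \<Rightarrow> 'a set" where
  "cls v = {s \<in> V. s \<noteq> r \<and> (s = v \<or> par s = par v \<and> {s, v} \<in> E)}"

definition has_child :: "'a \<Rightarrow> bool" where
  "has_child v \<longleftrightarrow> (\<exists>x \<in> V. x \<noteq> r \<and> par x = v)"

text \<open>The top vertex \<open>par v\<close> of the block is a cut vertex. If it is not the root,
  it always is one, since it separates \<open>v\<close> from its own parent.\<close>

definition par_cut :: "'a \<Rightarrow> bool" where
  "par_cut v \<longleftrightarrow> par v \<noteq> r \<or> (\<exists>u \<in> V. u \<noteq> r \<and> par u = r \<and> cls u \<noteq> cls v)"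

definition good :: "'a \<Rightarrow> bool" where
  "good v \<longleftrightarrow> card {s \<in> cls v. has_child s} + (if par_cut v then 1 else 0) \<le> 2"

definition good_classes :: "'a set set" where
  "good_classes = cls ` {v \<in> V - {r}. good v}"

definition desc :: "'a \<Rightarrow> 'a set" where
  "desc s = {x \<in> V. \<exists>k. (par ^^ k) x = s}"

text \<open>For \<open>a\<close> other than the root this is the component of \<open>a\<close> after
  deletion of \<open>par a\<close>.\<close>

definition below :: "'a \<Rightarrow> 'a set" where
  "below a = \<Union> (desc ` cls a)"

lemma cls_self: "v \<in> V \<Longrightarrow> v \<noteq> r \<Longrightarrow> v \<in> cls v"
  by (simp add: cls_def)

lemma clsD: "s \<in> cls v \<Longrightarrow> v \<noteq> r \<Longrightarrow> s \<in> V \<and> s \<noteq> r \<and> par s = par v"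
  by (auto simp: cls_def)

lemma cls_sub: "s \<in> cls v \<Longrightarrow> v \<noteq> r \<Longrightarrow> t \<in> cls s \<Longrightarrow> t \<in> cls v"
  unfolding cls_def using sibling_trans[of t s v] by auto

lemma cls_sym: "s \<in> cls v \<Longrightarrow> v \<in> V \<Longrightarrow> v \<noteq> r \<Longrightarrow> v \<in> cls s"
  by (auto simp: cls_def insert_commute)

text \<open>Transitivity of sibling adjacency makes the classes a partition of the non-root
  vertices.\<close>

lemma cls_eq: "s \<in> cls v \<Longrightarrow> v \<in> V \<Longrightarrow> v \<noteq> r \<Longrightarrow> cls s = cls v"
  using cls_sub[of s v] cls_sub[of v s] cls_sym[of s v] clsD[of s v] by blast

lemma cls_eq_par: "u \<in> V \<Longrightarrow> u \<noteq> r \<Longrightarrow> v \<noteq> r \<Longrightarrow> cls u = cls v \<Longrightarrow> par u = par v"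
  using cls_self[of u] clsD by auto

lemma cls_adj: "s \<in> cls v \<Longrightarrow> t \<in> cls v \<Longrightarrow> v \<in> V \<Longrightarrow> v \<noteq> r \<Longrightarrow> s \<noteq> t \<Longrightarrow> {s, t} \<in> E"
proof -
  assume *: "s \<in> cls v" "t \<in> cls v" "v \<in> V" "v \<noteq> r" "s \<noteq> t"
  then have "s \<in> cls t" using cls_eq by simp
  then show ?thesis using * by (simp add: cls_def)
qed

lemma cls_subset: "cls v \<subseteq> V"
  by (auto simp: cls_def)

lemma finite_cls: "finite (cls v)"
  using cls_subset finite_V finite_subset by blast

lemma good_cong: "u \<in> V \<Longrightarrow> u \<noteq> r \<Longrightarrow> v \<in> V \<Longrightarrow> v \<noteq> r \<Longrightarrow> cls u = cls v \<Longrightarrow> good u \<longleftrightarrow> good v"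
  using cls_eq_par[of u v] by (simp add: good_def par_cut_def)

lemma desc_subset: "desc s \<subseteq> V"
  by (auto simp: desc_def)

lemma desc_self: "s \<in> V \<Longrightarrow> s \<in> desc s"
  by (auto simp: desc_def intro: exI[of _ 0])

lemma desc_step: "x \<in> V \<Longrightarrow> par x \<in> desc s \<Longrightarrow> x \<in> desc s"
proof -
  assume "x \<in> V" "par x \<in> desc s"
  then obtain k where "(par ^^ Suc k) x = s"
    unfolding desc_def by (auto simp: funpow_Suc_right simp del: funpow.simps)
  then show ?thesis using \<open>x \<in> V\<close> unfolding desc_def by blast
qed

lemma desc_cases: "x \<in> desc s \<Longrightarrow> x = s \<or> x \<noteq> r \<and> par x \<in> desc s"
proof -
  assume x: "x \<in> desc s"
  then obtain k where k: "(par ^^ k) x = s" "x \<in> V" by (auto simp: desc_def)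
  show ?thesis
  proof (cases k)
    case 0
    then show ?thesis using k by simp
  next
    case (Suc l)
    then have "(par ^^ l) (par x) = s" using k by (simp add: funpow_Suc_right del: funpow.simps)
    then have p: "par x \<in> desc s" using k par_V by (auto simp: desc_def)
    \<comment> \<open>The root is a fixed point of \<open>par\<close>, so it is a descendant of
      nothing but itself.\<close>
    have "(par ^^ l) r = r" for l using root by (induction l) auto
    then show ?thesis using p k Suc root by auto
  qed
qed

lemma desc_ord: "x \<in> desc s \<Longrightarrow> x = s \<or> ord s < ord x"
proof -
  assume "x \<in> desc s"
  moreover from this have "x \<in> V" by (auto simp: desc_def)
  ultimately show ?thesis
  proof (induction "ord x" arbitrary: x rule: less_induct)
    case less
    show ?case
    proof (cases "x = s")
      case False
      then have x: "x \<noteq> r" "par x \<in> desc s" using desc_cases less.prems by auto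
      then have "par x = s \<or> ord s < ord (par x)" using less par par_V by auto
      then show ?thesis using par[of x] x less.prems by auto
    qed simp
  qed
qed

lemma par_notin_desc: "s \<in> V \<Longrightarrow> s \<noteq> r \<Longrightarrow> par s \<notin> desc s"
  using desc_ord[of "par s" s] par[of s] by auto

lemma desc_par: "s \<in> V \<Longrightarrow> desc s \<subseteq> desc (par s)"
proof
  fix x assume "x \<in> desc s" "s \<in> V"
  then obtain k where "x \<in> V" "(par ^^ Suc k) x = par s" by (auto simp: desc_def)
  then show "x \<in> desc (par s)" unfolding desc_def by blast
qed

text \<open>Climbing from a common descendant reaches \<open>s\<close> or \<open>t\<close> inside
  the subtree of the other; that subtree would then contain the common parent, against the
  order.\<close>

lemma desc_disjoint:
  assumes "s \<in> V" "t \<in> V" "s \<noteq> r" "t \<noteq> r" "par s = par t" "s \<noteq> t"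
  shows "desc s \<inter> desc t = {}"
proof -
  have "False" if "x \<in> V" "x \<in> desc s" "x \<in> desc t" for x
    using that
  proof (induction "ord x" arbitrary: x rule: less_induct)
    case less
    consider "x = s" | "x = t" | "x \<noteq> r" "par x \<in> desc s" "par x \<in> desc t"
      using desc_cases less.prems by blast
    then show ?case
    proof cases
      case 1
      then have "par s \<in> desc t" using desc_cases[OF less.prems(3)] assms by auto
      then show ?thesis using par_notin_desc assms by auto
    next
      case 2
      then have "par t \<in> desc s" using desc_cases[OF less.prems(2)] assms by auto
      then show ?thesis using par_notin_desc[of s] assms by auto
    next
      case 3
      then show ?thesis using less par par_V by blast
    qed
  qed
  then show ?thesis using desc_subset by blast
qed

lemma below_subset: "below a \<subseteq> V"
  using desc_subset by (auto simp: below_def)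

lemma desc_below: "s \<in> cls a \<Longrightarrow> desc s \<subseteq> below a"
  by (auto simp: below_def)

lemma below_par: "a \<noteq> r \<Longrightarrow> below a \<subseteq> desc (par a)"
  using clsD desc_par by (fastforce simp: below_def)

lemma par_notin_below: "a \<noteq> r \<Longrightarrow> par a \<notin> below a"
  using clsD[of _ a] par_notin_desc by (fastforce simp: below_def)

lemma desc_below_disjoint:
  assumes "c \<in> V" "c \<noteq> r" "a \<noteq> r" "par c = par a" "c \<notin> cls a"
  shows "desc c \<inter> below a = {}"
proof -
  have "desc c \<inter> desc s = {}" if "s \<in> cls a" for s
    by (rule desc_disjoint) (use assms that clsD in auto)
  then show ?thesis by (auto simp: below_def)
qed

subsection \<open>Branches\<close>

text \<open>The vertices that a shortest path starting with the step from \<open>a\<close> to \<open>b\<close> can reach.\<close>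

definition branch :: "'a \<Rightarrow> 'a \<Rightarrow> 'a set" where
  "branch a b = (if a \<noteq> r \<and> par a = b then V - below a else desc b)"

lemma branch_up: "a \<noteq> r \<Longrightarrow> branch a (par a) = V - below a"
  by (simp add: branch_def)

lemma branch_down: "b \<in> V \<Longrightarrow> b \<noteq> r \<Longrightarrow> branch (par b) b = desc b"
  using par_par_neq[of b] by (simp add: branch_def)

lemma branch_side: "b \<in> V \<Longrightarrow> b \<noteq> r \<Longrightarrow> par a = par b \<Longrightarrow> branch a b = desc b"
  using par_neq[of b] by (simp add: branch_def)

lemma edge_step:
  assumes "{a, b} \<in> E"
  obtains (up) "a \<in> V" "a \<noteq> r" "b = par a" | (down) "b \<in> V" "b \<noteq> r" "a = par b"
    | (side) "a \<in> V" "b \<in> V" "a \<noteq> r" "b \<noteq> r" "par a = par b" "b \<in> cls a" "a \<in> cls b"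
  using edge_cases[OF assms] edgeD[OF assms] assms by (auto simp: cls_def insert_commute)

lemma branch_self: "{a, b} \<in> E \<Longrightarrow> b \<in> branch a b"
  using edgeD[of a b] desc_self[of b] par_notin_below[of a] by (auto simp: branch_def)

lemma branch_start:
  assumes e: "{a, b} \<in> E"
  shows "a \<notin> branch a b"
  using e
proof (cases rule: edge_step)
  case up
  then have "a \<in> below a" using cls_self desc_self desc_below by blast
  then show ?thesis using up by (simp add: branch_up)
next
  case down
  then show ?thesis using par_notin_desc by (simp add: branch_down)
next
  case side
  then show ?thesis
    using edgeD[OF e] desc_disjoint[of a b] desc_self[of a] branch_side[of b a] by blast
qed

text \<open>The step to the parent reaches what lies outside \<open>below a\<close>; all other steps
  lead into subtrees inside \<open>below a\<close>, those of children of \<open>a\<close> or of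
  members of its class, and these are disjoint.\<close>

lemma branch_disjoint:
  assumes b: "{a, b} \<in> E" and c: "{a, c} \<in> E" and "b \<noteq> c"
  shows "branch a b \<inter> branch a c = {}"
proof -
  have disj_up: "branch a (par a) \<inter> branch a d = {}" if "{a, d} \<in> E" "a \<in> V" "a \<noteq> r" "d \<noteq> par a" for d
    using that(1)
  proof (cases rule: edge_step)
    case down
    then have "desc d \<subseteq> below a" using desc_par[of d] desc_below[OF cls_self] that by blast
    then show ?thesis using down that by (auto simp: branch_up branch_down)
  next
    case side
    then show ?thesis using desc_below[of d a] branch_up[of a] branch_side[of d a] by blast
  qed (use that in simp)
  have disj_side: "desc d \<inter> desc f = {}" if "{a, d} \<in> E" "a \<in> V" "a \<noteq> r" "par a = par d" "d \<noteq> r" "f \<in> V" "par f = a" for d f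
    using desc_disjoint[of a d] desc_par[of f] that edgeD[OF that(1)] by blast
  show ?thesis
    using b
  proof (cases rule: edge_step)
    case up
    then show ?thesis using disj_up c assms(3) by blast
  next
    case b: down
    show ?thesis
      using c
    proof (cases rule: edge_step)
      case up
      then show ?thesis using disj_up \<open>{a, b} \<in> E\<close> assms(3) by blast
    next
      case down
      then show ?thesis using b desc_disjoint[of b c] assms(3) by (metis branch_down)
    next
      case side
      then show ?thesis using b \<open>{a, c} \<in> E\<close> disj_side[of c b]
        by (metis branch_down branch_side inf_commute)
    qed
  next
    case b: side
    show ?thesis
      using c
    proof (cases rule: edge_step)
      case up
      then show ?thesis using disj_up \<open>{a, b} \<in> E\<close> assms(3) by blast
    next
      case down
      then show ?thesis using b \<open>{a, b} \<in> E\<close> disj_side[of b c]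
        by (metis branch_down branch_side)
    next
      case side
      then show ?thesis using b desc_disjoint[of b c] assms(3) by (metis branch_side)
    qed
  qed
qed

section \<open>Blocks as cliques, and branches along consecutive edges\<close>

definition block :: "'a \<Rightarrow> 'a set" where
  "block v = insert (par v) (cls v)"

lemma block_clique:
  assumes "v \<in> V" "v \<noteq> r" "s \<in> block v" "t \<in> block v" "s \<noteq> t"
  shows "{s, t} \<in> E"
proof -
  have "{x, par v} \<in> E \<and> {par v, x} \<in> E" if "x \<in> cls v" for x
    using par[of x] clsD[OF that assms(2)] edge_sym[of x "par v"] by auto
  moreover have "s = par v \<or> s \<in> cls v" "t = par v \<or> t \<in> cls v"
    using assms by (auto simp: block_def)
  ultimately show ?thesis
    using assms(1,2,5) cls_adj[of s v t] by blast
qed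

lemma block_cong: "u \<in> V \<Longrightarrow> u \<noteq> r \<Longrightarrow> v \<noteq> r \<Longrightarrow> cls u = cls v \<Longrightarrow> block u = block v"
  using cls_eq_par[of u v] by (simp add: block_def)

lemma edge_in_block:
  assumes "e \<in> E"
  shows "\<exists>v \<in> V. v \<noteq> r \<and> e \<subseteq> block v"
proof -
  obtain a b where e: "e = {a, b}" "{a, b} \<in> E" using edge_pair assms by blast
  from e(2) show ?thesis
  proof (cases rule: edge_step)
    case up
    then show ?thesis using e cls_self by (auto simp: block_def)
  next
    case down
    then show ?thesis using e cls_self by (auto simp: block_def)
  next
    case side
    then show ?thesis using e cls_self by (intro bexI[of _ a]) (auto simp: block_def)
  qed
qed

lemma edge_meets_cls:
  assumes "{a, b} \<in> E" "{a, b} \<subseteq> block v"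
  shows "{a, b} \<inter> cls v \<noteq> {}"
  using assms edgeD[of a b] by (auto simp: block_def)

text \<open>A common neighbour \<open>c\<close> is reached from \<open>a\<close> directly: it lies
  in \<open>branch a c\<close>, which is disjoint from \<open>branch a b\<close>.\<close>

lemma branch_common:
  assumes "{a, b} \<in> E" "{a, c} \<in> E" "{b, c} \<in> E"
  shows "c \<notin> branch a b"
  using branch_disjoint[of a b c] branch_self[of a c] edgeD[of b c] assms by blast

text \<open>The two edges are in different blocks, so \<open>b\<close> separates \<open>a\<close>
  from \<open>c\<close>. What can follow the second step can also follow the first, and what the
  first step leaves behind is reached by walking back.\<close>

lemma branch_chain:
  assumes ab: "{a, b} \<in> E" and bc: "{b, c} \<in> E" and ac: "a \<noteq> c" "{a, c} \<notin> E"
  shows "branch b c \<subseteq> branch a b \<and> V - branch a b \<subseteq> branch c b"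
  using ab
proof (cases rule: edge_step)
  case a: up
  have ba: "below a \<subseteq> desc b" using below_par a by simp
  have Ba: "branch a b = V - below a" using branch_up a by simp
  from bc show ?thesis
  proof (cases rule: edge_step)
    case up
    have "desc b \<subseteq> below b" using desc_below[OF cls_self] up by blast
    moreover have "branch b c = V - below b" "branch c b = desc b" using up branch_up branch_down by auto
    ultimately show ?thesis using ba Ba by blast
  next
    case down
    have "c \<notin> cls a" using ac edge_sym by (auto simp: cls_def insert_commute)
    then have "desc s \<inter> below a = {}" if "s \<in> cls c" for s
      using desc_below_disjoint[of s a] that clsD[of s c] cls_sub[of s a c] cls_sym[of s c] down a by metis
    then have "below c \<inter> below a = {}" by (auto simp: below_def)
    moreover have "branch b c = desc c" "branch c b = V - below c" "desc c \<subseteq> below c"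
      using down branch_up branch_down desc_below[OF cls_self] by auto
    ultimately show ?thesis using Ba desc_subset below_subset by blast
  next
    case side
    have "branch b c = desc c" "branch c b = desc b" "desc c \<inter> desc b = {}"
      using side branch_side[of c b] branch_side[of b c] desc_disjoint[of c b] edgeD[OF bc] by auto
    then show ?thesis using ba Ba desc_subset by blast
  qed
next
  case a: down
  have Ba: "branch a b = desc b" using branch_down a by simp
  from bc show ?thesis
  proof (cases rule: edge_step)
    case down
    have "branch b c = desc c" "branch c b = V - below c" "below c \<subseteq> desc b" "desc c \<subseteq> below c"
      using down branch_up branch_down desc_below[OF cls_self] below_par[of c] by auto
    then show ?thesis using Ba by blast
  next
    case side
    then have "{a, c} \<in> E" using a par[of c] by (simp add: insert_commute)
    then show ?thesis using ac by simp
  qed (use a ac in auto)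
next
  case a: side
  have Ba: "branch a b = desc b" using branch_side a by simp
  from bc show ?thesis
  proof (cases rule: edge_step)
    case up
    then have "{a, c} \<in> E" using a par[of a] by simp
    then show ?thesis using ac by simp
  next
    case down
    have "branch b c = desc c" "branch c b = V - below c" "below c \<subseteq> desc b" "desc c \<subseteq> below c"
      using down branch_up branch_down desc_below[OF cls_self] below_par[of c] by auto
    then show ?thesis using Ba by blast
  next
    case side
    then have "{a, c} \<in> E" using a ab bc sibling_trans[of a b c] ac by simp
    then show ?thesis using ac by simp
  qed
qed

subsection \<open>Shortest paths\<close>

text \<open>A local substitute for being shortest: only shortcuts past a single vertex are
  forbidden. It passes to suffixes and reversals, and \<open>branch_chain\<close> turns it into
  global information.\<close>

definition induced :: "'a list \<Rightarrow> bool" where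
  "induced p \<longleftrightarrow> successively (\<lambda>x y. {x, y} \<in> E) p \<and>
     (\<forall>xs a b c ys. p = xs @ a # b # c # ys \<longrightarrow> a \<noteq> c \<and> {a, c} \<notin> E)"

lemma induced_suffix: "induced (xs @ ys) \<Longrightarrow> induced ys"
  unfolding induced_def by (metis append_assoc successively_append_iff)

lemma induced_rev: "induced p \<Longrightarrow> induced (rev p)"
proof -
  assume p: "induced p"
  have "a \<noteq> c \<and> {a, c} \<notin> E" if "rev p = xs @ a # b # c # ys" for xs a b c ys
  proof -
    have "p = rev ys @ c # b # a # rev xs" using that by (simp add: rev_swap)
    then show ?thesis using p unfolding induced_def by (metis insert_commute)
  qed
  then show ?thesis using p by (auto simp: induced_def successively_rev insert_commute)
qed

lemma induced_head:
  assumes "induced (a # b # c # ys)"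
  shows "{a, b} \<in> E" "{b, c} \<in> E" "a \<noteq> c" "{a, c} \<notin> E"
proof -
  have "a # b # c # ys = [] @ a # b # c # ys" by simp
  then show "a \<noteq> c" "{a, c} \<notin> E" using assms unfolding induced_def by blast+
qed (use assms in \<open>auto simp: induced_def\<close>)

lemma induced_branch: "induced (a # b # ys) \<Longrightarrow> set (b # ys) \<subseteq> branch a b"
proof (induction ys arbitrary: a b)
  case Nil
  then show ?case using branch_self by (simp add: induced_def)
next
  case (Cons c ys)
  have "set (c # ys) \<subseteq> branch b c"
    using Cons.IH Cons.prems induced_suffix[of "[a]"] by simp
  then show ?case
    using branch_chain[of a b c] branch_self[of a b] induced_head[OF Cons.prems] by auto
qed

text \<open>Branches shrink along the path, so their complements grow, and each complement lies in
  the backward branch of the next edge.\<close>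

lemma induced_branch_later:
  "induced (a # b # ys) \<Longrightarrow> b # ys = zs @ c # d # ws \<Longrightarrow> V - branch a b \<subseteq> branch d c"
proof (induction zs arbitrary: a b ys)
  case Nil
  then show ?case using branch_chain[of a b d] induced_head[of a b d ws] by simp
next
  case (Cons z zs)
  then obtain y ys' where ys: "ys = y # ys'" "z = b" by (cases ys) auto
  have "V - branch b y \<subseteq> branch d c"
    using Cons induced_suffix[of "[a]"] ys by simp
  then show ?case
    using branch_chain[of a b y] induced_head[of a b y ys'] Cons.prems(1) ys by blast
qed

lemma shortest_path_induced:
  assumes "shortest_path V E u v p"
  shows "induced p"
proof -
  have p: "path_between V E u v p" using assms by (simp add: shortest_path_def)
  have "a \<noteq> c \<and> {a, c} \<notin> E" if s: "p = xs @ a # b # c # ys" for xs a b c ys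
  proof -
    have "{a, c} \<notin> E"
    proof
      assume "{a, c} \<in> E"
      then have "path_between V E u v (xs @ a # c # ys)"
        using p unfolding path_between_def s
        by (auto simp: successively_append_iff hd_append split: if_splits)
      then show False using assms s unfolding shortest_path_def by fastforce
    qed
    then show ?thesis using p s by (auto simp: path_between_def)
  qed
  then show ?thesis using p by (auto simp: induced_def path_between_def)
qed

end

lemma path_edges_Cons2 [simp]: "path_edges (a # b # p) = {a, b} # path_edges (b # p)"
  by (simp add: path_edges_def)

lemma path_edges_short [simp]: "path_edges [] = []" "path_edges [a] = []"
  by (simp_all add: path_edges_def)

lemma set_path_edges: "e \<in> set (path_edges p) \<Longrightarrow> \<exists>xs a b ys. p = xs @ a # b # ys \<and> e = {a, b}"
proof (induction p rule: induct_list012)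
  case (3 a b p)
  then consider "e = {a, b}" | "e \<in> set (path_edges (b # p))" by auto
  then show ?case
  proof cases
    case 1
    then show ?thesis by (metis append_Nil)
  next
    case 2
    then show ?thesis using 3(2) by (metis append_Cons)
  qed
qed auto

lemma path_edges_append: "{a, b} \<in> set (path_edges (xs @ a # b # ys))"
proof (induction xs)
  case (Cons x xs)
  then show ?case by (cases xs) auto
qed simp

lemma rainbow_pathI:
  assumes "\<And>xs a b ys zs c d ws. p = xs @ a # b # ys \<Longrightarrow> b # ys = zs @ c # d # ws \<Longrightarrow> f {a, b} \<noteq> f {c, d}"
  shows "rainbow_path f p"
  using assms
proof (induction p rule: induct_list012)
  case (3 a b p)
  have "rainbow_path f (b # p)"
    by (rule 3(2)) (metis 3(3) append_Cons)
  moreover have "f {a, b} \<noteq> f e" if "e \<in> set (path_edges (b # p))" for e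
    using set_path_edges[OF that] 3(3)[of "[]" a b p] by auto
  ultimately show ?case by (auto simp: rainbow_path_def)
qed (auto simp: rainbow_path_def)

context clique_tree begin

subsection \<open>Upper bound\<close>

lemma good_classes_subset: "D \<in> good_classes \<Longrightarrow> \<exists>v \<in> V. v \<noteq> r \<and> good v \<and> D = cls v"
  by (auto simp: good_classes_def)

lemma finite_good_classes: "finite good_classes"
  using finite_V by (simp add: good_classes_def)

lemma desc_has_child: "x \<in> desc s \<Longrightarrow> x \<noteq> s \<Longrightarrow> has_child s"
proof -
  assume x: "x \<in> desc s" "x \<noteq> s"
  then have "x \<in> V" by (auto simp: desc_def)
  then show ?thesis
    using x
  proof (induction rule: vertex_induct)
    case root
    then show ?case using desc_cases[of r s] by simp
  next
    case (step v)
    then have "par v \<in> desc s" using desc_cases[of v s] by auto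
    then show ?case using step by (auto simp: has_child_def)
  qed
qed

text \<open>A class in \<open>U\<close> with parents as late as possible has no children in \<open>U\<close>.\<close>

lemma good_class_in:
  assumes U: "U \<subseteq> V - {r}" "U \<noteq> {}"
    and cls: "\<And>u. u \<in> U \<Longrightarrow> cls u \<subseteq> U"
    and child: "\<And>u x. u \<in> U \<Longrightarrow> x \<in> V \<Longrightarrow> x \<noteq> r \<Longrightarrow> par x = u \<Longrightarrow> x \<in> U \<or> u = y"
  shows "\<exists>D \<in> good_classes. D \<subseteq> U"
proof -
  have fin: "finite ((\<lambda>v. ord (par v)) ` U)" using U finite_V finite_subset by blast
  obtain k where k: "k \<in> U" using U by blast
  have "ord (par u) < Suc (Max ((\<lambda>v. ord (par v)) ` U))" if "u \<in> U" for u
    using fin that by (simp add: le_imp_less_Suc)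
  then obtain v where v: "v \<in> U" "\<And>u. u \<in> U \<Longrightarrow> ord (par u) \<le> ord (par v)"
    using Lattices_Big.ex_has_greatest_nat[of "\<lambda>v. v \<in> U" k "\<lambda>v. ord (par v)"] k by blast
  have vV: "v \<in> V" "v \<noteq> r" using v U by auto
  \<comment> \<open>A child of \<open>s\<close> has a later parent than \<open>v\<close> has, so the
    choice of \<open>v\<close> puts it outside \<open>U\<close>; only the exceptional vertex
    \<open>y\<close> may have such children.\<close>
  have "{s \<in> cls v. has_child s} \<subseteq> {y}"
  proof clarsimp
    fix s assume s: "s \<in> cls v" "has_child s"
    then obtain x where x: "x \<in> V" "x \<noteq> r" "par x = s" by (auto simp: has_child_def)
    have sU: "s \<in> U" using cls v(1) s by blast
    have sv: "s \<in> V" "s \<noteq> r" "par s = par v" using clsD[OF s(1)] vV by auto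
    then have "ord (par v) < ord (par x)" using par[of s] x by simp
    then have "x \<notin> U" using v(2)[of x] by linarith
    then show "s = y" using child[OF sU x] by blast
  qed
  then have "card {s \<in> cls v. has_child s} \<le> 1"
    by (metis card_mono finite.emptyI finite.insertI is_singletonI is_singleton_altdef)
  \<comment> \<open>One cut vertex in the class and possibly the top vertex make at most
    two.\<close>
  then have "good v" by (simp add: good_def)
  then have "cls v \<in> good_classes" using vV by (auto simp: good_classes_def)
  then show ?thesis using cls v(1) by blast
qed

text \<open>The quantifiers cover both orientations of the edge, so no induced path through it meets
  \<open>D\<close> on either side.\<close>

definition avoids :: "'a set \<Rightarrow> 'a set \<Rightarrow> bool" where
  "avoids D e \<longleftrightarrow> (\<forall>a b. e = {a, b} \<longrightarrow> D \<inter> branch a b = {})"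

lemma desc_branch_disjoint:
  assumes "v \<in> V" "v \<noteq> r" "a \<in> block v" "b \<in> block v" "a \<noteq> b" "w \<in> cls v" "w \<noteq> a" "w \<noteq> b"
  shows "desc w \<inter> branch a b = {}"
proof (cases "b = par v")
  case True
  then have a: "a \<in> cls v" "b = par a" "a \<noteq> r" using assms clsD[of a v] by (auto simp: block_def)
  then have "w \<in> cls a" using assms cls_eq[of a v] by simp
  then show ?thesis using a branch_up[of a] desc_below[of w a] by auto
next
  case False
  then have b: "b \<in> cls v" using assms by (auto simp: block_def)
  have bw: "b \<in> V" "b \<noteq> r" "par b = par v" "w \<in> V" "w \<noteq> r" "par w = par v"
    using clsD[OF b] clsD[of w v] assms by auto
  have "branch a b = desc b"
  proof (cases "a = par v")
    case True
    then show ?thesis using bw branch_down[of b] by simp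
  next
    case False
    then show ?thesis using assms(2,3) clsD[of a v] bw branch_side[of b a] by (simp add: block_def)
  qed
  then show ?thesis using desc_disjoint[of w b] bw assms by simp
qed

text \<open>Pigeonhole: the block has at least three cut vertices, and \<open>e\<close> covers at
  most two.\<close>

lemma bad_cut_vertices:
  assumes v: "v \<in> V" "v \<noteq> r" and bad: "\<not> good v" and e: "card e \<le> 2" "finite e"
  shows "(\<exists>w \<in> cls v. has_child w \<and> w \<notin> e) \<or> par_cut v \<and> par v \<notin> e"
proof (rule ccontr)
  assume neg: "\<not> ?thesis"
  let ?K = "{s \<in> cls v. has_child s}"
  have K: "?K \<subseteq> e" "finite ?K" using neg finite_cls by auto
  show False
  proof (cases "par_cut v")
    case True
    have "par v \<notin> ?K" using clsD[of "par v" v] v par_neq[of v] par_par_neq[of v]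
      by (metis (no_types, lifting) mem_Collect_eq par_neq)
    then have "card (insert (par v) ?K) = Suc (card ?K)" using K by simp
    moreover have "card (insert (par v) ?K) \<le> card e"
      using K neg True e by (intro card_mono) auto
    ultimately show False using bad e True by (simp add: good_def)
  next
    case False
    moreover have "card ?K \<le> card e" using K e by (intro card_mono) auto
    ultimately show False using bad e by (simp add: good_def)
  qed
qed

text \<open>Trades the local definition for the existence of something behind the top vertex. If
  \<open>par v\<close> is not the root, it is itself a witness; otherwise the outside vertices hang
  in other classes of the root.\<close>

lemma par_cut_outside:
  assumes v: "v \<in> V" "v \<noteq> r"
  shows "par_cut v \<longleftrightarrow> (\<exists>u \<in> V. u \<noteq> r \<and> u \<notin> below v)"
proof
  assume "par_cut v"
  then consider "par v \<noteq> r" | u where "u \<in> V" "u \<noteq> r" "par u = r" "cls u \<noteq> cls v" "par v = r"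
    by (auto simp: par_cut_def)
  then show "\<exists>u \<in> V. u \<noteq> r \<and> u \<notin> below v"
  proof cases
    case 1
    then show ?thesis using par_notin_below[of v] par_V[of v] v by auto
  next
    case 2
    then have "u \<notin> cls v" using cls_eq[of u v] v by auto
    then have "desc u \<inter> below v = {}" using desc_below_disjoint[of u v] 2 v by simp
    then show ?thesis using 2 desc_self[of u] by auto
  qed
next
  assume "\<exists>u \<in> V. u \<noteq> r \<and> u \<notin> below v"
  then obtain u where u: "u \<in> V" "u \<noteq> r" "u \<notin> below v" by blast
  have "\<exists>t \<in> V. t \<noteq> r \<and> par t = r \<and> u \<in> desc t"
    using u(1,2)
  proof (induction rule: vertex_induct)
    case (step x)
    then show ?case
      by (cases "par x = r") (use desc_self in blast, use desc_step in blast)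
  qed simp
  then obtain t where t: "t \<in> V" "t \<noteq> r" "par t = r" "u \<in> desc t" by blast
  have "cls t \<noteq> cls v" using t u cls_self[of t] desc_below[of t v] by blast
  then show "par_cut v" using t by (auto simp: par_cut_def)
qed

text \<open>In a bad block, \<open>good_class_in\<close> is applied to what lies behind the missed
  cut vertex: strictly below \<open>w\<close>, or outside \<open>below v\<close> if the top vertex
  is missed.\<close>

lemma color_exists:
  assumes e: "e \<in> E"
  shows "\<exists>D \<in> good_classes. (\<exists>v \<in> V. v \<noteq> r \<and> e \<subseteq> block v \<and> D = cls v) \<or> avoids D e"
proof -
  obtain v where v: "v \<in> V" "v \<noteq> r" "e \<subseteq> block v" using edge_in_block e by blast
  obtain a0 b0 where e2: "e = {a0, b0}" "a0 \<noteq> b0" using edge_pair e by blast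
  show ?thesis
  proof (cases "good v")
    case True
    then have "cls v \<in> good_classes" using v by (auto simp: good_classes_def)
    then show ?thesis using v by blast
  next
    case False
    have "card e \<le> 2" "finite e" using e2 by auto
    from bad_cut_vertices[OF v(1,2) False this]
    consider w where "w \<in> cls v" "has_child w" "w \<notin> e" | "par_cut v" "par v \<notin> e" by blast
    then show ?thesis
    proof cases
      case 1
      define U where "U = {x \<in> V. x \<noteq> r \<and> par x \<in> desc w}"
      have w: "w \<in> V" "w \<noteq> r" using 1 clsD v by auto
      have "\<exists>D \<in> good_classes. D \<subseteq> U"
      proof (rule good_class_in)
        show "U \<noteq> {}" using 1(2) w desc_self[of w] by (auto simp: has_child_def U_def)
        show "cls u \<subseteq> U" if "u \<in> U" for u
          using that clsD[of _ u] by (auto simp: U_def)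
        show "x \<in> U \<or> u = w" if "u \<in> U" "x \<in> V" "x \<noteq> r" "par x = u" for u x
          using that desc_step[of u w] by (auto simp: U_def)
      qed (auto simp: U_def)
      then obtain D where D: "D \<in> good_classes" "D \<subseteq> U" by blast
      have "D \<inter> branch a b = {}" if "e = {a, b}" for a b
      proof -
        have "a \<noteq> b" using that e2 by (auto simp: doubleton_eq_iff)
        then have "desc w \<inter> branch a b = {}"
          using desc_branch_disjoint[of v a b w] that v 1 by auto
        moreover have "U \<subseteq> desc w" using desc_step by (auto simp: U_def)
        ultimately show ?thesis using D by blast
      qed
      then show ?thesis using D by (auto simp: avoids_def)
    next
      case 2
      define U where "U = {x \<in> V. x \<noteq> r \<and> x \<notin> below v}"
      have "\<exists>D \<in> good_classes. D \<subseteq> U"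
      proof (rule good_class_in)
        show "U \<noteq> {}" using 2(1) par_cut_outside[OF v(1,2)] by (auto simp: U_def)
        show "cls u \<subseteq> U" if u: "u \<in> U" for u
        proof
          fix s assume s: "s \<in> cls u"
          have "s \<notin> below v"
          proof
            assume "s \<in> below v"
            then obtain t where t: "t \<in> cls v" "s \<in> desc t" by (auto simp: below_def)
            have uV: "u \<in> V" "u \<noteq> r" "u \<notin> below v" using u by (auto simp: U_def)
            show False
            proof (cases "s = t")
              case True
              then have "u \<in> cls v" using t s cls_sub[of t v u] cls_sym[of t u] v uV by simp
              then show False using uV desc_self desc_below by blast
            next
              case False
              then have "par u \<in> desc t" using t desc_cases[of s t] clsD[OF s] uV by auto
              then show False using desc_step[of u t] uV t desc_below[of t v] by blast
            qed
          qed
          then show "s \<in> U" using u clsD[OF s] by (auto simp: U_def)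
        qed
        \<comment> \<open>Only children of \<open>par v\<close> can lead from \<open>U\<close> into
          \<open>below v\<close>, so \<open>par v\<close> is the exceptional vertex.\<close>
        show "x \<in> U \<or> u = par v" if "u \<in> U" "x \<in> V" "x \<noteq> r" "par x = u" for u x
        proof (rule disjCI)
          assume u: "u \<noteq> par v"
          have "x \<notin> below v"
          proof
            assume "x \<in> below v"
            then obtain t where t: "t \<in> cls v" "x \<in> desc t" by (auto simp: below_def)
            then have "x \<noteq> t" using u that clsD[of t v] v by auto
            then have "u \<in> desc t" using t desc_cases[of x t] that by auto
            then show False using that t desc_below[of t v] by (auto simp: U_def)
          qed
          then show "x \<in> U" using that by (simp add: U_def)
        qed
      qed (auto simp: U_def)
      then obtain D where D: "D \<in> good_classes" "D \<subseteq> U" by blast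
      have "D \<inter> branch a b = {}" if "e = {a, b}" for a b
      proof -
        \<comment> \<open>The edge misses the top vertex, so both ends are in the class and both
          branches are subtrees inside \<open>below v\<close>.\<close>
        have ab: "a \<in> cls v" "b \<in> cls v" using that v 2 by (auto simp: block_def)
        then have "branch a b = desc b" using clsD[of a v] clsD[of b v] v branch_side[of b a] by simp
        then show ?thesis using D desc_below[of b v] ab by (auto simp: U_def)
      qed
      then show ?thesis using D by (auto simp: avoids_def)
    qed
  qed
qed

text \<open>If both edges are in the block of \<open>D\<close>, some end of one is a common
  neighbour of the ends of the other, against \<open>branch_common\<close>. If one is in the block
  and the other avoids \<open>D\<close>, the first meets \<open>D\<close> inside a branch of the
  second. If both avoid \<open>D\<close>, the two branches cover \<open>V\<close>, although
  \<open>D\<close> is nonempty.\<close>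

lemma color_conflict:
  assumes e: "{a, b} \<in> E" and f: "{c, d} \<in> E"
    and D: "D \<in> good_classes"
    and De: "(\<exists>v \<in> V. v \<noteq> r \<and> {a, b} \<subseteq> block v \<and> D = cls v) \<or> avoids D {a, b}"
    and Df: "(\<exists>v \<in> V. v \<noteq> r \<and> {c, d} \<subseteq> block v \<and> D = cls v) \<or> avoids D {c, d}"
    and far: "{c, d} \<subseteq> branch a b" "{a, b} \<subseteq> branch d c" "V - branch a b \<subseteq> branch d c"
  shows False
proof -
  have av: "D \<inter> branch a b = {}" if "avoids D {a, b}" using that by (simp add: avoids_def)
  have av': "D \<inter> branch d c = {}" if "avoids D {c, d}" using that
    unfolding avoids_def by (metis insert_commute)
  consider v u where "v \<in> V" "v \<noteq> r" "{a, b} \<subseteq> block v" "D = cls v"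
        "u \<in> V" "u \<noteq> r" "{c, d} \<subseteq> block u" "D = cls u"
    | v where "{a, b} \<subseteq> block v" "D = cls v" "D \<inter> branch d c = {}"
    | u where "{c, d} \<subseteq> block u" "D = cls u" "D \<inter> branch a b = {}"
    | "D \<inter> branch a b = {}" "D \<inter> branch d c = {}"
    using De Df av av' by blast
  then show False
  proof cases
    case 1
    then have "block u = block v" using block_cong[of u v] by simp
    obtain z where z: "z \<in> {c, d}" "z \<noteq> b" using edgeD[OF f] by auto
    then have "z \<noteq> a" using far(1) branch_start[OF e] by blast
    moreover have "a \<in> block v" "b \<in> block v" "z \<in> block v"
      using z(1) 1(3,7) \<open>block u = block v\<close> by auto
    ultimately have "{a, z} \<in> E" "{b, z} \<in> E"
      using block_clique[OF 1(1,2)] z(2) by metis+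
    then show False using branch_common[OF e] far(1) z by blast
  next
    case 2
    then show False using edge_meets_cls[OF e] far(2) by blast
  next
    case 3
    then show False using edge_meets_cls[OF f] far(1) by blast
  next
    case 4
    obtain v where "v \<in> V" "v \<noteq> r" "D = cls v" using good_classes_subset D by blast
    then have "v \<in> D" "v \<in> V" using cls_self by auto
    then show False using 4 far(3) by blast
  qed
qed

lemma induced_far:
  assumes p: "induced (xs @ a # b # ys)" and q: "b # ys = zs @ c # d # ws"
  shows "{a, b} \<in> E" "{c, d} \<in> E" "{c, d} \<subseteq> branch a b" "{a, b} \<subseteq> branch d c" "V - branch a b \<subseteq> branch d c"
proof -
  have p1: "induced (a # b # ys)" using p by (rule induced_suffix)
  show "{c, d} \<subseteq> branch a b" using induced_branch[OF p1] unfolding q by auto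
  show "V - branch a b \<subseteq> branch d c" using induced_branch_later[OF p1 q] .
  show "{a, b} \<in> E" using p1 by (simp add: induced_def)
  have "induced ((xs @ a # zs) @ c # d # ws)" using p q by simp
  then have "induced (c # d # ws)" by (rule induced_suffix)
  then show "{c, d} \<in> E" by (simp add: induced_def)
  have "induced (rev ws @ d # c # rev zs @ a # rev xs)"
    using induced_rev[OF p] q by simp
  then have "induced (d # c # rev zs @ a # rev xs)" by (rule induced_suffix)
  then have "set (c # rev zs @ a # rev xs) \<subseteq> branch d c" by (rule induced_branch)
  moreover have "b \<in> set (zs @ [c])" using q by (cases zs) auto
  ultimately show "{a, b} \<subseteq> branch d c" by auto
qed

lemma coloring_exists:
  "\<exists>f :: 'a set \<Rightarrow> nat. (\<forall>p. induced p \<longrightarrow> rainbow_path f p) \<and> card (f ` E) \<le> card good_classes"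
proof -
  obtain col where col: "\<And>e. e \<in> E \<Longrightarrow> col e \<in> good_classes \<and>
      ((\<exists>v \<in> V. v \<noteq> r \<and> e \<subseteq> block v \<and> col e = cls v) \<or> avoids (col e) e)"
    using color_exists by metis
  \<comment> \<open>Classes serve as colours first; they are renamed to numbers because
    \<open>strong_rainbow_connection_number\<close> ranges over colourings by
    \<open>nat\<close>.\<close>
  obtain num :: "'a set \<Rightarrow> nat" where num: "inj_on num good_classes"
    using finite_good_classes finite_imp_inj_to_nat_seg by meson
  have "rainbow_path (num \<circ> col) p" if p: "induced p" for p
  proof (rule rainbow_pathI)
    fix xs a b ys zs c d ws assume s: "p = xs @ a # b # ys" "b # ys = zs @ c # d # ws"
    note far = induced_far[OF p[unfolded s(1)] s(2)]
    have "col {a, b} \<noteq> col {c, d}"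
      using color_conflict[OF far(1,2) _ _ _ far(3-5), of "col {a, b}"] col[OF far(1)] col[OF far(2)] by auto
    then show "(num \<circ> col) {a, b} \<noteq> (num \<circ> col) {c, d}"
      using num col far(1,2) by (auto dest: inj_onD)
  qed
  moreover have "card ((num \<circ> col) ` E) \<le> card good_classes"
  proof -
    have "(num \<circ> col) ` E \<subseteq> num ` good_classes" using col by auto
    then have "card ((num \<circ> col) ` E) \<le> card (num ` good_classes)"
      using finite_good_classes by (intro card_mono) auto
    then show ?thesis using card_image_le[OF finite_good_classes, of num] by linarith
  qed
  ultimately show ?thesis by blast
qed

subsection \<open>Lower bound\<close>

text \<open>Every other block lies behind a single cut vertex of this one. If its class meets
  \<open>below v\<close>, it hangs under one member \<open>s\<close>, which therefore has a child;
  otherwise it lies beyond \<open>par v\<close>.\<close>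

lemma block_below:
  assumes u: "u \<in> V" "u \<noteq> r" and v: "v \<in> V" "v \<noteq> r" and ne: "cls u \<noteq> cls v"
  shows "(\<exists>s \<in> cls v. has_child s \<and> block u \<subseteq> desc s) \<or> par_cut v \<and> block u \<subseteq> V - below v"
proof (cases "cls u \<inter> below v = {}")
  case True
  have "par u \<notin> below v"
  proof
    assume "par u \<in> below v"
    then have "u \<in> below v" using desc_step[of u] u by (auto simp: below_def)
    then show False using True cls_self u by blast
  qed
  moreover have "par_cut v" using par_cut_outside[OF v] u True cls_self by blast
  ultimately show ?thesis using True par_V[of u] u cls_subset by (auto simp: block_def)
next
  case False
  then obtain t s where t: "t \<in> cls u" "s \<in> cls v" "t \<in> desc s" by (auto simp: below_def)
  have "t \<noteq> s" using t ne cls_eq[of t u] cls_eq[of s v] u v by auto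
  then have "par u \<in> desc s" using desc_cases[OF t(3)] clsD[OF t(1)] u by auto
  then have "x \<in> desc s" if "x \<in> cls u" for x
    using desc_step[of x s] clsD[OF that] u by simp
  then show ?thesis using t \<open>par u \<in> desc s\<close> desc_has_child[of t s] \<open>t \<noteq> s\<close> by (auto simp: block_def)
qed

lemma branch_in_block:
  assumes "v \<in> V" "v \<noteq> r" "s \<in> cls v" "t \<in> block v" "s \<noteq> t"
  shows "branch t s = desc s"
  using clsD[OF assms(3,2)] clsD[of t v] assms branch_down[of s] branch_side[of s t]
  by (auto simp: block_def)

lemma good_edge:
  assumes v: "v \<in> V" "v \<noteq> r" and g: "good v"
  shows "\<exists>e \<in> E. e \<subseteq> block v \<and> (\<forall>u \<in> V. u \<noteq> r \<longrightarrow> cls u \<noteq> cls v \<longrightarrow>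
    (\<exists>a b. e = {a, b} \<and> block u \<subseteq> branch a b))"
proof -
  let ?K = "{s \<in> cls v. has_child s}"
  have finK: "finite ?K" using finite_cls by simp
  have down: "\<exists>a b. {s, t} = {a, b} \<and> f \<subseteq> branch a b"
    if "s \<in> cls v" "t \<in> block v" "s \<noteq> t" "f \<subseteq> desc s" for s t f
    using branch_in_block[OF v that(1-3)] that(4) by (intro exI[of _ t] exI[of _ s]) auto
  have up: "\<exists>a b. {s, par v} = {a, b} \<and> f \<subseteq> branch a b"
    if "s \<in> cls v" "f \<subseteq> V - below v" for s f
    using clsD[OF that(1) v(2)] branch_up[of s] cls_eq[OF that(1) v] that
    by (intro exI[of _ s] exI[of _ "par v"]) (auto simp: below_def)
  \<comment> \<open>With at most one cut vertex \<open>k\<close> in the class, the edge from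
    \<open>k\<close> to the top vertex serves; if there is none, \<open>k\<close> is
    \<open>v\<close>. Two of them leave no room for the top vertex as a third one, and they form the
    edge.\<close>
  consider k where "k \<in> cls v" "?K \<subseteq> {k}" | a b where "\<not> par_cut v" "?K = {a, b}" "a \<noteq> b"
  proof -
    have "card ?K \<le> 2" using g by (auto simp: good_def split: if_splits)
    then consider "card ?K = 0" | "card ?K = 1" | "card ?K = 2" by linarith
    then show thesis
    proof cases
      case 1
      then show ?thesis using that(1)[of v] finK cls_self[OF v] by auto
    next
      case 2
      then obtain k where "?K = {k}" by (auto simp: card_1_singleton_iff)
      then show ?thesis using that(1)[of k] by blast
    next
      case 3
      then obtain a b where "?K = {a, b}" "a \<noteq> b" by (auto simp: card_2_iff)
      moreover have "\<not> par_cut v" using g 3 by (simp add: good_def split: if_splits)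
      ultimately show ?thesis using that(2) by blast
    qed
  qed
  then show ?thesis
  proof cases
    case 1
    have k: "k \<in> V" "k \<noteq> r" "par k = par v" using clsD[OF 1(1) v(2)] by auto
    have "\<exists>a b. {k, par v} = {a, b} \<and> block u \<subseteq> branch a b"
      if u: "u \<in> V" "u \<noteq> r" "cls u \<noteq> cls v" for u
    proof -
      consider s where "s \<in> ?K" "block u \<subseteq> desc s" | "block u \<subseteq> V - below v"
        using block_below[OF u(1,2) v u(3)] by blast
      then show ?thesis
      proof cases
        case 1
        then have "s = k" using \<open>?K \<subseteq> {k}\<close> by blast
        then show ?thesis
          using down[of k "par v" "block u"] 1 \<open>k \<in> cls v\<close> k par_neq[of k] by (auto simp: block_def)
      next
        case 2
        then show ?thesis using up[of k "block u"] \<open>k \<in> cls v\<close> by blast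
      qed
    qed
    moreover have "{k, par v} \<in> E" "{k, par v} \<subseteq> block v"
      using par[of k] k 1(1) by (auto simp: block_def)
    ultimately show ?thesis by blast
  next
    case 2
    have ab: "a \<in> cls v" "b \<in> cls v" using 2 by auto
    have "\<exists>x y. {a, b} = {x, y} \<and> block u \<subseteq> branch x y"
      if u: "u \<in> V" "u \<noteq> r" "cls u \<noteq> cls v" for u
    proof -
      obtain s where s: "s \<in> ?K" "block u \<subseteq> desc s"
        using block_below[OF u(1,2) v u(3)] 2(1) by blast
      then have "s = a \<or> s = b" unfolding 2(2) by simp
      then consider "block u \<subseteq> desc a" | "block u \<subseteq> desc b" using s(2) by blast
      then show ?thesis
      proof cases
        case 1
        then show ?thesis using down[of a b "block u"] ab 2(3) by (auto simp: block_def)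
      next
        case 2
        then show ?thesis using down[of b a "block u"] ab \<open>a \<noteq> b\<close> by (auto simp: block_def insert_commute)
      qed
    qed
    moreover have "{a, b} \<in> E" "{a, b} \<subseteq> block v"
      using cls_adj[OF ab v 2(3)] ab by (auto simp: block_def)
    ultimately show ?thesis by blast
  qed
qed

lemma rainbow_far_edges:
  assumes src: "strongly_rainbow_connected V E f"
    and ab: "{a, b} \<in> E" and cd: "{c, d} \<in> E"
    and far: "{c, d} \<subseteq> branch a b" "{a, b} \<subseteq> branch d c"
  shows "f {a, b} \<noteq> f {c, d}"
proof -
  obtain p where sp: "shortest_path V E a d p" and rb: "rainbow_path f p"
    using src edgeD[OF ab] edgeD[OF cd] unfolding strongly_rainbow_connected_def by blast
  have ind: "induced p" using shortest_path_induced[OF sp] .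
  have p: "p \<noteq> []" "hd p = a" "last p = d" using sp by (auto simp: shortest_path_def path_between_def)
  have "a \<noteq> d" using branch_start[OF ab] far by blast
  \<comment> \<open>Branches of different neighbours are disjoint, so the target \<open>z\<close>
    determines the first step of an induced path from \<open>x\<close>. Applied to \<open>p\<close>
    and to its reversal, this puts both edges on \<open>p\<close>.\<close>
  have first: "\<exists>ys. q = x # y # ys"
    if q: "induced q" "q \<noteq> []" "hd q = x" "last q = z" "x \<noteq> z" "{x, y} \<in> E" "z \<in> branch x y" for q x y z
  proof -
    obtain y' ys where q': "q = x # y' # ys"
      using q(2-5) by (cases q; cases "tl q") auto
    have "z \<in> branch x y'" "{x, y'} \<in> E"
      using induced_branch[of x y' ys] q q' last_in_set[of "y' # ys"] by (auto simp: induced_def)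
    then show ?thesis using branch_disjoint[of x y y'] q q' by blast
  qed
  obtain ys where "p = a # b # ys"
    using first[OF ind p \<open>a \<noteq> d\<close> ab] far by blast
  then have 1: "{a, b} \<in> set (path_edges p)" by simp
  obtain zs where "rev p = d # c # zs"
    using first[of "rev p" d a c] induced_rev[OF ind] p \<open>a \<noteq> d\<close> cd far
    by (auto simp: hd_rev last_rev insert_commute)
  then have "p = rev zs @ c # d # []" by (simp add: rev_swap)
  then have 2: "{c, d} \<in> set (path_edges p)" using path_edges_append by metis
  have "{a, b} \<noteq> {c, d}" using branch_start[OF ab] far by blast
  then show ?thesis using rb 1 2 unfolding rainbow_path_def distinct_map by (meson inj_onD)
qed

text \<open>The edges chosen in two good blocks lie beyond each other, so the colouring is injective
  on the chosen edges.\<close>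

lemma good_classes_lower_bound:
  assumes "strongly_rainbow_connected V E f"
  shows "card good_classes \<le> card (f ` E)"
proof -
  define rep where "rep D = (SOME v. v \<in> V \<and> v \<noteq> r \<and> good v \<and> D = cls v)" for D
  have rep: "rep D \<in> V" "rep D \<noteq> r" "good (rep D)" "cls (rep D) = D" if "D \<in> good_classes" for D
    using someI_ex[of "\<lambda>v. v \<in> V \<and> v \<noteq> r \<and> good v \<and> D = cls v"] good_classes_subset[OF that]
    unfolding rep_def by blast+
  have "\<exists>e. e \<in> E \<and> e \<subseteq> block (rep D) \<and> (\<forall>u \<in> V. u \<noteq> r \<longrightarrow> cls u \<noteq> D \<longrightarrow>
    (\<exists>a b. e = {a, b} \<and> block u \<subseteq> branch a b))" if "D \<in> good_classes" for D
    using good_edge[of "rep D"] rep[OF that] by metis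
  then obtain ed where ed: "\<And>D. D \<in> good_classes \<Longrightarrow> ed D \<in> E"
    "\<And>D. D \<in> good_classes \<Longrightarrow> ed D \<subseteq> block (rep D)"
    "\<And>D u. D \<in> good_classes \<Longrightarrow> u \<in> V \<Longrightarrow> u \<noteq> r \<Longrightarrow> cls u \<noteq> D \<Longrightarrow>
      \<exists>a b. ed D = {a, b} \<and> block u \<subseteq> branch a b" by metis
  have "inj_on (f \<circ> ed) good_classes"
  proof (rule inj_onI, rule ccontr)
    fix C D assume CD: "C \<in> good_classes" "D \<in> good_classes" "(f \<circ> ed) C = (f \<circ> ed) D" "C \<noteq> D"
    obtain a b where ab: "ed C = {a, b}" "block (rep D) \<subseteq> branch a b"
      using ed(3)[OF CD(1) rep(1,2)[OF CD(2)]] rep(4)[OF CD(2)] CD(4) by blast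
    \<comment> \<open>This edge is read from \<open>d\<close> to \<open>c\<close>, the orientation
      that points towards the other block.\<close>
    obtain d c where cd: "ed D = {d, c}" "block (rep C) \<subseteq> branch d c"
      using ed(3)[OF CD(2) rep(1,2)[OF CD(1)]] rep(4)[OF CD(1)] CD(4) by blast
    have "{a, b} \<in> E" "{c, d} \<in> E" "{c, d} \<subseteq> branch a b" "{a, b} \<subseteq> branch d c"
      using ab cd ed(1,2)[OF CD(1)] ed(1,2)[OF CD(2)] by (auto simp: insert_commute)
    then have "f {a, b} \<noteq> f {c, d}" by (rule rainbow_far_edges[OF assms])
    then show False using CD(3) ab cd by (simp add: insert_commute)
  qed
  moreover have "(f \<circ> ed) ` good_classes \<subseteq> f ` E" using ed(1) by auto
  ultimately show ?thesis using finite_E card_inj_on_le by blast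
qed

end

theorem (in clique_tree) strong_rainbow_connection_number_eq:
  assumes conn: "connected_graph V E"
  shows "strong_rainbow_connection_number V E = card good_classes"
proof -
  obtain f :: "'a set \<Rightarrow> nat" where f: "\<And>p. induced p \<Longrightarrow> rainbow_path f p" "card (f ` E) \<le> card good_classes"
    using coloring_exists by blast
  have "\<exists>p. shortest_path V E u v p \<and> rainbow_path f p" if uv: "u \<in> V" "v \<in> V" for u v
  proof -
    obtain q where "path_between V E u v q" using conn uv by (auto simp: connected_graph_def)
    then obtain p where "path_between V E u v p" "\<And>q. path_between V E u v q \<Longrightarrow> length p \<le> length q"
      using ex_has_least_nat[of "path_between V E u v" q length] by blast
    then have "shortest_path V E u v p" by (simp add: shortest_path_def)
    then show ?thesis using f(1) shortest_path_induced by blast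
  qed
  then have src: "strongly_rainbow_connected V E f"
    by (simp add: strongly_rainbow_connected_def)
  show ?thesis
    unfolding strong_rainbow_connection_number_def
  proof (rule Least_equality)
    have "card (f ` E) = card good_classes"
      using f(2) good_classes_lower_bound[OF src] by simp
    then show "\<exists>c :: 'a set \<Rightarrow> nat. strongly_rainbow_connected V E c \<and> card (c ` E) = card good_classes"
      using src by blast
    show "card good_classes \<le> k"
      if "\<exists>c :: 'a set \<Rightarrow> nat. strongly_rainbow_connected V E c \<and> card (c ` E) = k" for k
      using that good_classes_lower_bound by blast
  qed
qed

sublocale search_order \<subseteq> clique_tree
proof
  show "simple_graph V E" using bg by (simp add: block_graph_def)
qed (fact root par edge_cases sibling_trans)+

section \<open>Counting classes by their least vertices\<close>

locale ordered_clique_tree = clique_tree V E r par ord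
  for V :: "'a :: linorder set" and E r par ord
begin

definition leader :: "'a \<Rightarrow> bool" where
  "leader v \<longleftrightarrow> (\<forall>s \<in> cls v. v \<le> s)"

definition cut_count :: "'a \<Rightarrow> nat" where
  "cut_count v = card {s \<in> cls v. has_child s}"

lemma leader_exists:
  assumes "v \<in> V" "v \<noteq> r"
  shows "\<exists>u \<in> cls v. u \<in> V \<and> u \<noteq> r \<and> leader u \<and> cls u = cls v"
proof -
  have u: "Min (cls v) \<in> cls v" using cls_self[OF assms] finite_cls by (intro Min_in) auto
  moreover have "cls (Min (cls v)) = cls v" using cls_eq[OF u assms] .
  ultimately show ?thesis
    using clsD[OF u assms(2)] finite_cls by (auto simp: leader_def)
qed

lemma leader_unique:
  assumes "u \<in> V" "u \<noteq> r" "v \<in> V" "v \<noteq> r" "leader u" "leader v" "cls u = cls v"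
  shows "u = v"
proof -
  have "u \<in> cls v" "v \<in> cls u" using assms cls_self by blast+
  then show ?thesis using assms(5,6) by (auto simp: leader_def intro: antisym)
qed

lemma card_good_classes:
  "card good_classes = card {v \<in> V - {r}. leader v \<and> good v}"
proof -
  have "bij_betw cls {v \<in> V - {r}. leader v \<and> good v} good_classes"
  proof (rule bij_betw_imageI)
    show "inj_on cls {v \<in> V - {r}. leader v \<and> good v}"
      using leader_unique by (auto intro!: inj_onI)
    show "cls ` {v \<in> V - {r}. leader v \<and> good v} = good_classes"
    proof (intro subset_antisym subsetI)
      fix D assume "D \<in> good_classes"
      then obtain v where v: "v \<in> V" "v \<noteq> r" "good v" "D = cls v" using good_classes_subset by blast
      obtain u where u: "u \<in> V" "u \<noteq> r" "leader u" "cls u = cls v" using leader_exists v by blast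
      then have "good u" using good_cong[of u v] v by simp
      then show "D \<in> cls ` {v \<in> V - {r}. leader v \<and> good v}" using u v by auto
    qed (auto simp: good_classes_def)
  qed
  then show ?thesis using bij_betw_same_card by fastforce
qed

text \<open>The classes below the root correspond to their leaders, so the root fails to be a cut
  vertex exactly if there is just one such leader.\<close>

lemma par_cut_leader:
  assumes "v \<in> V" "v \<noteq> r" "leader v"
  shows "par_cut v \<longleftrightarrow> \<not> (par v = r \<and> card {u \<in> V - {r}. leader u \<and> par u = r} = 1)"
proof (cases "par v = r")
  case True
  let ?R = "{u \<in> V - {r}. leader u \<and> par u = r}"
  have fin: "finite ?R" using finite_V by simp
  have v: "v \<in> ?R" using assms True by simp
  have "par_cut v \<longleftrightarrow> (\<exists>u \<in> ?R. u \<noteq> v)"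
  proof
    assume "par_cut v"
    then obtain u where u: "u \<in> V" "u \<noteq> r" "par u = r" "cls u \<noteq> cls v"
      using True by (auto simp: par_cut_def)
    obtain w where w: "w \<in> cls u" "w \<in> V" "w \<noteq> r" "leader w" "cls w = cls u"
      using leader_exists u by blast
    then have "w \<in> ?R" "w \<noteq> v" using u clsD[OF w(1)] by auto
    then show "\<exists>u \<in> ?R. u \<noteq> v" by blast
  next
    assume "\<exists>u \<in> ?R. u \<noteq> v"
    then obtain u where u: "u \<in> ?R" "u \<noteq> v" by blast
    then have "cls u \<noteq> cls v" using leader_unique assms by blast
    then show "par_cut v" using u by (auto simp: par_cut_def)
  qed
  also have "\<dots> \<longleftrightarrow> card ?R \<noteq> 1"
  proof
    assume "\<exists>u \<in> ?R. u \<noteq> v"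
    then show "card ?R \<noteq> 1" using v by (metis card_1_singletonE singletonD)
  next
    assume "card ?R \<noteq> 1"
    then show "\<exists>u \<in> ?R. u \<noteq> v"
      using v by (metis (no_types, lifting) is_singletonI' is_singleton_altdef empty_iff)
  qed
  finally show ?thesis using True by simp
qed (simp add: par_cut_def)

text \<open>Whether the root is a cut vertex is known only after all classes have been seen, so the
  classes of the root with two further cut vertices are counted separately.\<close>

lemma card_good_classes_leaders:
  "card good_classes = card {v \<in> V - {r}. leader v \<and> cut_count v \<le> 1} +
    (if card {v \<in> V - {r}. leader v \<and> par v = r} = 1
     then card {v \<in> V - {r}. leader v \<and> par v = r \<and> cut_count v = 2} else 0)"
proof -
  let ?one = "card {v \<in> V - {r}. leader v \<and> par v = r} = 1"
  let ?A = "{v \<in> V - {r}. leader v \<and> cut_count v \<le> 1}"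
  let ?B = "if ?one then {v \<in> V - {r}. leader v \<and> par v = r \<and> cut_count v = 2} else {}"
  have g: "good v \<longleftrightarrow> cut_count v \<le> 1 \<or> cut_count v = 2 \<and> par v = r \<and> ?one"
    if "v \<in> V" "v \<noteq> r" "leader v" for v
  proof -
    have "good v \<longleftrightarrow> cut_count v + (if par_cut v then 1 else 0) \<le> 2"
      by (simp add: good_def cut_count_def)
    also have "\<dots> \<longleftrightarrow> cut_count v \<le> 1 \<or> cut_count v = 2 \<and> \<not> par_cut v" by auto
    finally show ?thesis using par_cut_leader[OF that] by simp
  qed
  have "{v \<in> V - {r}. leader v \<and> good v} = ?A \<union> ?B"
  proof (intro set_eqI)
    fix v
    show "v \<in> {v \<in> V - {r}. leader v \<and> good v} \<longleftrightarrow> v \<in> ?A \<union> ?B"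
      using g[of v] by (cases ?one) (simp_all, blast+)
  qed
  moreover have "finite ?A" "finite ?B" "?A \<inter> ?B = {}"
    using finite_V by auto
  ultimately have "card {v \<in> V - {r}. leader v \<and> good v} = card ?A + card ?B"
    using card_Un_disjoint[of ?A ?B] by simp
  then show ?thesis unfolding card_good_classes by (simp split: if_splits)
qed

end

section \<open>Time-bounded weakest preconditions\<close>

text \<open>The postcondition also sees the part of the time budget \<open>T\<close> that is left.\<close>

definition wp :: "nat \<Rightarrow> program \<Rightarrow> (ram_state \<Rightarrow> nat \<Rightarrow> bool) \<Rightarrow> ram_state \<Rightarrow> nat \<Rightarrow> bool" where
  "wp W P Q s T \<longleftrightarrow> (\<exists>t s'. ram_exec W P s t s' \<and> t \<le> T \<and> Q s' (T - t))"

lemma wp_basic: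
  assumes "\<And>t s'. ram_exec W P s t s' \<longleftrightarrow> ok \<and> t = 1 \<and> s' = u"
  shows "wp W P Q s T \<longleftrightarrow> ok \<and> 1 \<le> T \<and> Q u (T - 1)"
  unfolding wp_def assms by auto

lemma wp_Skip: "wp W Skip Q s T \<longleftrightarrow> 1 \<le> T \<and> Q s (T - 1)"
proof -
  have "ram_exec W Skip s t s' \<longleftrightarrow> True \<and> t = 1 \<and> s' = s" for t s'
    by (auto elim: ram_exec_cases(1) intro: ram_exec.Skip simp del: One_nat_def)
  from wp_basic[OF this] show ?thesis by simp
qed

lemma wp_Move: "wp W (Move x a) Q (R, M) T \<longleftrightarrow>
    operand_val R a < W \<and> 1 \<le> T \<and> Q (R(x := operand_val R a), M) (T - 1)"
  by (rule wp_basic) (auto elim: ram_exec_cases(2) intro: ram_exec.Move simp del: One_nat_def)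

lemma wp_Add: "wp W (Add x a b) Q (R, M) T \<longleftrightarrow>
    operand_val R a + operand_val R b < W \<and> 1 \<le> T \<and>
    Q (R(x := operand_val R a + operand_val R b), M) (T - 1)"
  by (rule wp_basic) (auto elim: ram_exec_cases(3) intro: ram_exec.Add simp del: One_nat_def)

lemma wp_Load: "wp W (Load x a) Q (R, M) T \<longleftrightarrow>
    (operand_val R a < W \<and> M (operand_val R a) < W) \<and> 1 \<le> T \<and>
    Q (R(x := M (operand_val R a)), M) (T - 1)"
  by (rule wp_basic) (auto elim: ram_exec_cases(5) intro: ram_exec.Load simp del: One_nat_def)

lemma wp_Store: "wp W (Store a b) Q (R, M) T \<longleftrightarrow>
    (operand_val R a < W \<and> operand_val R b < W) \<and> 1 \<le> T \<and>
    Q (R, M(operand_val R a := operand_val R b)) (T - 1)"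
  by (rule wp_basic) (auto elim: ram_exec_cases(6) intro: ram_exec.Store simp del: One_nat_def)

lemma wp_Sequence: "wp W (Sequence P P') Q s T \<longleftrightarrow> wp W P (wp W P' Q) s T"
proof
  assume "wp W (Sequence P P') Q s T"
  then obtain t s' where e: "ram_exec W (Sequence P P') s t s'" and t: "t \<le> T" "Q s' (T - t)"
    by (auto simp: wp_def)
  from e obtain t1 s1 t2 where "ram_exec W P s t1 s1" "ram_exec W P' s1 t2 s'" "t = t1 + t2"
    by (rule ram_exec_cases(7))
  then show "wp W P (wp W P' Q) s T" using t unfolding wp_def
    by (intro exI[of _ t1] exI[of _ s1] conjI exI[of _ t2] exI[of _ s']) auto
next
  assume "wp W P (wp W P' Q) s T"
  then obtain t1 s1 t2 s' where e: "ram_exec W P s t1 s1" "ram_exec W P' s1 t2 s'"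
      and t: "t1 \<le> T" "t2 \<le> T - t1" "Q s' (T - t1 - t2)"
    by (auto simp: wp_def)
  from e have "ram_exec W (Sequence P P') s (t1 + t2) s'" by (rule ram_exec.Sequence)
  then show "wp W (Sequence P P') Q s T" using t unfolding wp_def
    by (intro exI[of _ "t1 + t2"] exI[of _ s']) auto
qed

lemma wp_Branch:
  "wp W (Branch b P P') Q s T \<longleftrightarrow> 1 \<le> T \<and> wp W (if test_val (fst s) b then P else P') Q s (T - 1)"
proof
  assume "wp W (Branch b P P') Q s T"
  then obtain t s' where e: "ram_exec W (Branch b P P') s t s'" and t: "t \<le> T" "Q s' (T - t)"
    by (auto simp: wp_def)
  from e obtain t1 where "ram_exec W (if test_val (fst s) b then P else P') s t1 s'" "t = 1 + t1"
    by cases auto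
  then show "1 \<le> T \<and> wp W (if test_val (fst s) b then P else P') Q s (T - 1)"
    using t unfolding wp_def by (intro conjI exI[of _ t1] exI[of _ s']) auto
next
  assume *: "1 \<le> T \<and> wp W (if test_val (fst s) b then P else P') Q s (T - 1)"
  then obtain t s' where e: "ram_exec W (if test_val (fst s) b then P else P') s t s'"
      and t: "t \<le> T - 1" "Q s' (T - 1 - t)"
    by (auto simp: wp_def)
  have "ram_exec W (Branch b P P') s (1 + t) s'"
    using e ram_exec.BranchTrue ram_exec.BranchFalse by (cases "test_val (fst s) b") simp_all
  then show "wp W (Branch b P P') Q s T" using t * unfolding wp_def
    by (intro exI[of _ "1 + t"] exI[of _ s']) auto
qed

text \<open>No variant is needed because every iteration uses up part of the budget.\<close>

lemma wp_Loop:
  assumes "I s T"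
    and step: "\<And>s T. I s T \<Longrightarrow> test_val (fst s) b \<Longrightarrow> 1 \<le> T \<and> wp W P I s (T - 1)"
    and exit: "\<And>s T. I s T \<Longrightarrow> \<not> test_val (fst s) b \<Longrightarrow> 1 \<le> T \<and> Q s (T - 1)"
  shows "wp W (Loop b P) Q s T"
  using assms(1)
proof (induction T arbitrary: s rule: less_induct)
  case (less T)
  show ?case
  proof (cases "test_val (fst s) b")
    case True
    then obtain t1 s1 where e1: "ram_exec W P s t1 s1" and t1: "1 \<le> T" "t1 \<le> T - 1" "I s1 (T - 1 - t1)"
      using step[OF less.prems] by (auto simp: wp_def)
    then have "wp W (Loop b P) Q s1 (T - 1 - t1)" by (intro less.IH) auto
    then obtain t2 s2 where e2: "ram_exec W (Loop b P) s1 t2 s2"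
        and t2: "t2 \<le> T - 1 - t1" "Q s2 (T - 1 - t1 - t2)"
      by (auto simp: wp_def)
    have "ram_exec W (Loop b P) s (1 + t1 + t2) s2" using True e1 e2 by (rule ram_exec.LoopStep)
    then show ?thesis using t1 t2 unfolding wp_def
      by (intro exI[of _ "1 + t1 + t2"] exI[of _ s2]) auto
  next
    case False
    then have "ram_exec W (Loop b P) s 1 s" by (rule ram_exec.LoopExit)
    then show ?thesis using exit[OF less.prems False] unfolding wp_def by blast
  qed
qed

text \<open>The closing \<open>Skip\<close> costs one step, which the generous constants in the time
  bounds absorb.\<close>

fun seqs :: "program list \<Rightarrow> program" where
  "seqs [] = Skip"
| "seqs (P # Ps) = Sequence P (seqs Ps)"

lemmas wp_simps = wp_Skip wp_Move wp_Add wp_Load wp_Store wp_Sequence wp_Branch seqs.simps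

section \<open>The program\<close>

text \<open>
  Registers: 1 is \<open>n\<close>; 2, 3 and 4 are the start addresses of three arrays of length \<open>n\<close> behind the
  input, holding the parents (increased by 1, with \<open>n + 1\<close> for the root and 0 for undiscovered
  vertices), the queue, and the flags of the vertices with children; 6 is the loop index, 7 the
  length of the queue, 8 the current vertex (in the search) or its parent entry (when counting),
  and 9 and 10 delimit the unread part of the current adjacency list. When counting, 14 is the number
  of vertices with children in the class of the current vertex, and 17 tells whether the current
  vertex is the least of its class; 0, 15 and 16 count the least vertices of those classes that
  contain at most one vertex with children, have the root as parent, and both have the root as parent
  and contain two vertices with children.
\<close>

definition init_prog :: program where
  "init_prog = seqs
    [Load 1 (Imm 0), Add 2 (Reg 1) (Imm 2), Load 2 (Reg 2), Add 3 (Reg 2) (Reg 1),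
     Add 4 (Reg 3) (Reg 1), Add 5 (Reg 1) (Imm 1), Store (Reg 2) (Reg 5),
     Move 6 (Imm 0), Move 7 (Imm 1)]"

definition next_neighbour :: program where
  "next_neighbour = seqs
    [Load 11 (Reg 9), Add 9 (Reg 9) (Imm 1), Add 12 (Reg 2) (Reg 11), Load 13 (Reg 12)]"

definition discover :: program where
  "discover = seqs
    [Add 14 (Reg 8) (Imm 1), Store (Reg 12) (Reg 14), Add 14 (Reg 3) (Reg 7),
     Store (Reg 14) (Reg 11), Add 7 (Reg 7) (Imm 1), Add 14 (Reg 4) (Reg 8), Store (Reg 14) (Imm 1)]"

definition search_list :: program where
  "search_list = Loop (Less (Reg 9) (Reg 10))
    (seqs [next_neighbour, Branch (Equal (Reg 13) (Imm 0)) discover Skip])"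

definition search :: program where
  "search = Loop (Less (Reg 6) (Reg 7)) (seqs
    [Add 8 (Reg 3) (Reg 6), Load 8 (Reg 8), Add 9 (Reg 8) (Imm 2), Load 9 (Reg 9),
     Add 10 (Reg 8) (Imm 3), Load 10 (Reg 10), search_list, Add 6 (Reg 6) (Imm 1)])"

definition count_list :: program where
  "count_list = Loop (Less (Reg 9) (Reg 10)) (seqs
    [next_neighbour,
     Branch (Equal (Reg 13) (Reg 8))
       (seqs [Add 12 (Reg 4) (Reg 11), Load 12 (Reg 12), Add 14 (Reg 14) (Reg 12),
              Branch (Less (Reg 11) (Reg 6)) (Move 17 (Imm 0)) Skip])
       Skip])"

definition count :: program where
  "count = Loop (Less (Reg 6) (Reg 1)) (seqs
    [Add 9 (Reg 6) (Imm 2), Load 9 (Reg 9), Add 10 (Reg 6) (Imm 3), Load 10 (Reg 10),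
     Add 8 (Reg 2) (Reg 6), Load 8 (Reg 8), Add 12 (Reg 4) (Reg 6), Load 14 (Reg 12),
     Move 17 (Imm 1), count_list,
     Branch (Equal (Reg 17) (Imm 1))
       (seqs [Branch (Less (Reg 14) (Imm 2)) (Add 0 (Reg 0) (Imm 1)) Skip,
              Branch (Equal (Reg 8) (Imm 1))
                (seqs [Add 15 (Reg 15) (Imm 1),
                       Branch (Equal (Reg 14) (Imm 2)) (Add 16 (Reg 16) (Imm 1)) Skip])
                Skip])
       Skip,
     Add 6 (Reg 6) (Imm 1)])"

definition src_prog :: program where
  "src_prog = seqs
    [init_prog, search, Move 6 (Imm 1), Move 0 (Imm 0), Move 15 (Imm 0), Move 16 (Imm 0), count,
     Branch (Equal (Reg 15) (Imm 1)) (Add 0 (Reg 0) (Reg 16)) Skip]"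

section \<open>Memory\<close>

text \<open>The bound on \<open>W\<close> covers all memory in use: the input takes at most
  \<open>n + 3 + 2 * card E\<close> cells and the three arrays take \<open>3 * n\<close>, which
  leaves a little slack.\<close>

locale graph_input =
  fixes n :: nat and E :: "nat set set" and adj :: "nat list list" and W :: nat
  assumes bg: "block_graph {..<n} E" and conn: "connected_graph {..<n} E"
    and adj: "adjacency_lists n E adj"
    and W: "4 * n + 2 * card E + 5 < W"
begin

definition L :: nat where
  "L = n + 3 + length (concat adj)"

definition off :: "nat \<Rightarrow> nat" where
  "off v = n + 3 + length (concat (take v adj))"

definition inp :: "nat list" where
  "inp = graph_encoding n (card E) adj"

text \<open>Giving the arrays as functions turns stores into function updates, see
  \<open>mem_update\<close>.\<close>

definition mem :: "(nat \<Rightarrow> nat) \<Rightarrow> (nat \<Rightarrow> nat) \<Rightarrow> (nat \<Rightarrow> nat) \<Rightarrow> nat \<Rightarrow> nat" where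
  "mem A B C x = (if x < L then inp ! x else if x < L + n then A (x - L)
     else if x < L + n + n then B (x - (L + n)) else if x < L + n + n + n then C (x - (L + n + n)) else 0)"

lemma simple: "simple_graph {..<n} E"
  using bg by (simp add: block_graph_def)

lemma finite_E: "finite E"
  using simple by (rule simple_graph_finite_edges)

lemma edgeD: "{u, v} \<in> E \<Longrightarrow> u < n \<and> v < n"
  using simple by (auto simp: simple_graph_def)

lemma n_pos: "0 < n"
  using conn by (auto simp: connected_graph_def)

lemma length_adj: "length adj = n"
  using adj by (simp add: adjacency_lists_def)

lemma set_adj: "v < n \<Longrightarrow> set (adj ! v) = {w. {v, w} \<in> E}"
  using adj by (simp add: adjacency_lists_def)

lemma distinct_adj: "v < n \<Longrightarrow> distinct (adj ! v)"
  using adj by (simp add: adjacency_lists_def)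

lemma length_concat_take: "k \<le> n \<Longrightarrow> length (concat (take k adj)) = (\<Sum>v<k. length (adj ! v))"
  by (induction k) (auto simp: take_Suc_conv_app_nth length_adj)

lemma length_concat: "length (concat adj) = (\<Sum>v<n. length (adj ! v))"
  using length_concat_take[of n] length_adj by simp

text \<open>Double counting: the list entries are ordered pairs of adjacent vertices, and an edge
  accounts for at most two of them.\<close>

lemma length_concat_le: "length (concat adj) \<le> 2 * card E"
proof -
  have fin: "finite (set (adj ! v))" for v by simp
  have "length (concat adj) = (\<Sum>v<n. card (set (adj ! v)))"
    unfolding length_concat using distinct_adj by (intro sum.cong) (auto simp: distinct_card)
  also have "\<dots> = card (SIGMA v:{..<n}. set (adj ! v))" by (simp add: card_SigmaI)
  also have "\<dots> \<le> card (\<Union>e\<in>E. {(u, v). {u, v} = e})"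
  proof (rule card_mono)
    have "finite {(u, v). {u, v} = e}" if "e \<in> E" for e
    proof (rule finite_subset)
      show "{(u, v). {u, v} = e} \<subseteq> e \<times> e" by auto
      have "card e = 2" using simple that by (simp add: simple_graph_def)
      then show "finite (e \<times> e)" using card_ge_0_finite[of e] by simp
    qed
    then show "finite (\<Union>e\<in>E. {(u, v). {u, v} = e})" using finite_E by blast
    show "(SIGMA v:{..<n}. set (adj ! v)) \<subseteq> (\<Union>e\<in>E. {(u, v). {u, v} = e})"
      using set_adj by auto
  qed
  also have "\<dots> \<le> (\<Sum>e\<in>E. card {(u, v). {u, v} = e})"
    by (rule card_UN_le[OF finite_E])
  also have "\<dots> \<le> (\<Sum>e\<in>E. 2)"
  proof (rule sum_mono)
    fix e assume "e \<in> E"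
    then have "card e = 2" using simple by (simp add: simple_graph_def)
    then obtain a b where "e = {a, b}" by (auto simp: card_2_iff)
    then have "{(u, v). {u, v} = e} \<subseteq> {(a, b), (b, a)}" by (auto simp: doubleton_eq_iff)
    then have "card {(u, v). {u, v} = e} \<le> card {(a, b), (b, a)}"
      by (intro card_mono) simp_all
    also have "card {(a, b), (b, a)} \<le> 2" by (cases "a = b") simp_all
    finally show "card {(u, v). {u, v} = e} \<le> 2" .
  qed
  finally show ?thesis by simp
qed

lemma length_inp: "length inp = L"
  by (simp add: inp_def L_def graph_encoding_def)

lemma off_Suc: "v < n \<Longrightarrow> off (Suc v) = off v + length (adj ! v)"
  by (simp add: off_def take_Suc_conv_app_nth length_adj)

lemma off_le: "v \<le> n \<Longrightarrow> off v \<le> L"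
  unfolding off_def L_def length_concat using length_concat_take[of v]
  by (auto intro: sum_mono2)

lemma bounds: "L + 3 * n + 2 < W" "n + 3 \<le> L"
  using W length_concat_le by (auto simp: L_def)

lemma inp_0: "inp ! 0 = n"
  by (simp add: inp_def graph_encoding_def)

lemma inp_off: "v \<le> n \<Longrightarrow> inp ! (v + 2) = off v"
  by (simp add: inp_def graph_encoding_def nth_append off_def del: upt_Suc)

lemma inp_off3: "v < n \<Longrightarrow> inp ! (v + 3) = off v + length (adj ! v)"
  using inp_off[of "Suc v"] off_Suc[of v] by (simp add: numeral_3_eq_3 numeral_2_eq_2)

text \<open>The end marker of the lists is the first free address, so one load finds the base of the
  arrays.\<close>

lemma inp_L: "inp ! (n + 2) = L"
  using inp_off[of n] by (simp add: off_def L_def length_adj)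

lemma inp_adj:
  assumes "v < n" "j < length (adj ! v)"
  shows "inp ! (off v + j) = adj ! v ! j"
proof -
  have "concat adj = concat (take v adj) @ adj ! v @ concat (drop (Suc v) adj)"
    using id_take_nth_drop[of v adj] assms(1) length_adj by (metis concat.simps(2) concat_append)
  then have "concat adj ! (length (concat (take v adj)) + j) = adj ! v ! j"
    using assms(2) by (simp add: nth_append)
  then show ?thesis
    by (simp add: inp_def graph_encoding_def off_def nth_append del: upt_Suc)
qed

lemma off_less: "v < n \<Longrightarrow> j < length (adj ! v) \<Longrightarrow> off v + j < L"
  using off_Suc[of v] off_le[of "Suc v"] by simp

lemma adj_less: "v < n \<Longrightarrow> j < length (adj ! v) \<Longrightarrow> adj ! v ! j < n"
  using set_adj[of v] edgeD nth_mem[of j "adj ! v"] by auto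

lemma mem_inp [simp]: "x < L \<Longrightarrow> mem A B C x = inp ! x"
  by (simp add: mem_def)

lemma mem_arrays [simp]:
  assumes "v < n"
  shows "mem A B C (L + v) = A v" "mem A B C (L + n + v) = B v" "mem A B C (L + n + n + v) = C v"
  using assms by (simp_all add: mem_def)

lemma mem_update [simp]:
  assumes "v < n"
  shows "(mem A B C)(L + v := x) = mem (A(v := x)) B C"
    "(mem A B C)(L + n + v := x) = mem A (B(v := x)) C"
    "(mem A B C)(L + n + n + v := x) = mem A B (C(v := x))"
  using assms by (auto simp: mem_def fun_eq_iff)

end

context graph_input begin

subsection \<open>The search\<close>

text \<open>The root entry \<open>n + 1\<close> exceeds every \<open>par w + 1\<close>, so a
  comparison of parent entries never takes the root for a sibling of its children.\<close>

definition state_mem :: "nat list \<Rightarrow> (nat \<Rightarrow> nat) \<Rightarrow> nat \<Rightarrow> nat" where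
  "state_mem qs par = mem
     (\<lambda>w. if w \<in> set qs then if w = 0 then n + 1 else par w + 1 else 0)
     (\<lambda>l. if l < length qs then qs ! l else 0)
     (\<lambda>u. if \<exists>w \<in> set qs. w \<noteq> 0 \<and> par w = u then 1 else 0)"

definition base :: "(nat \<Rightarrow> nat) \<Rightarrow> bool" where
  "base R \<longleftrightarrow> R 1 = n \<and> R 2 = L \<and> R 3 = L + n \<and> R 4 = L + n + n"

text \<open>The first \<open>h\<close> vertices of the queue are processed, and all parents are among the first \<open>k\<close>.\<close>

definition queue :: "nat list \<Rightarrow> (nat \<Rightarrow> nat) \<Rightarrow> nat \<Rightarrow> nat \<Rightarrow> bool" where
  "queue qs par h k \<longleftrightarrow> distinct qs \<and> set qs \<subseteq> {..<n} \<and> qs \<noteq> [] \<and> qs ! 0 = 0 \<and> par 0 = 0 \<and>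
     (\<forall>l<length qs. 0 < l \<longrightarrow> (\<exists>i<l. i < k \<and> par (qs ! l) = qs ! i \<and> {qs ! l, qs ! i} \<in> E \<and>
        (\<forall>j<i. {qs ! l, qs ! j} \<notin> E))) \<and>
     (\<forall>i<h. \<forall>w. {qs ! i, w} \<in> E \<longrightarrow> w \<in> set qs)"

lemma queue_0: "queue qs par h k \<Longrightarrow> 0 \<in> set qs"
  unfolding queue_def by (metis length_greater_0_conv nth_mem)

lemma queue_less: "queue qs par h k \<Longrightarrow> w \<in> set qs \<Longrightarrow> w < n"
  by (auto simp: queue_def)

lemma queue_length:
  assumes "queue qs par h k" "w < n" "w \<notin> set qs"
  shows "length qs < n"
proof -
  have "card (set qs) < card {..<n}"
    using assms by (intro psubset_card_mono) (auto simp: queue_def)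
  then show ?thesis using assms by (simp add: queue_def distinct_card)
qed

lemma queue_length_le: "queue qs par h k \<Longrightarrow> length qs \<le> n"
  using card_mono[of "{..<n}" "set qs"] by (simp add: queue_def distinct_card)

text \<open>A processed vertex adjacent to \<open>w\<close> would already have put \<open>w\<close>
  into the queue, so the current vertex is the earliest neighbour of \<open>w\<close>.\<close>

lemma queue_append:
  assumes q: "queue qs par h (Suc h)" and h: "h < length qs" and w: "w \<notin> set qs" "{qs ! h, w} \<in> E"
  shows "queue (qs @ [w]) (par(w := qs ! h)) h (Suc h)"
proof -
  have w0: "w \<noteq> 0" "w < n" using queue_0[OF q] w(1) edgeD[OF w(2)] by metis+
  have "\<exists>i<l. i < Suc h \<and> (par(w := qs ! h)) ((qs @ [w]) ! l) = (qs @ [w]) ! i \<and>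
      {(qs @ [w]) ! l, (qs @ [w]) ! i} \<in> E \<and> (\<forall>j<i. {(qs @ [w]) ! l, (qs @ [w]) ! j} \<notin> E)"
    if l: "l < Suc (length qs)" "0 < l" for l
  proof (cases "l = length qs")
    case True
    have "{w, qs ! j} \<notin> E" if "j < h" for j
    proof
      assume "{w, qs ! j} \<in> E"
      then have "{qs ! j, w} \<in> E" by (simp add: insert_commute)
      then show False using q w(1) that by (simp add: queue_def)
    qed
    then show ?thesis
      using True h w(2) by (intro exI[of _ h]) (simp add: nth_append insert_commute)
  next
    case False
    then have l': "l < length qs" using l by simp
    then obtain i where i: "i < l" "i < Suc h" "par (qs ! l) = qs ! i" "{qs ! l, qs ! i} \<in> E"
        "\<forall>j<i. {qs ! l, qs ! j} \<notin> E"
      using q l(2) unfolding queue_def by blast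
    have "qs ! l \<noteq> w" using l' w by auto
    then show ?thesis using i l' by (intro exI[of _ i]) (simp add: nth_append)
  qed
  moreover have "w' \<in> insert w (set qs)" if "i < h" "{(qs @ [w]) ! i, w'} \<in> E" for i w'
  proof -
    have "{qs ! i, w'} \<in> E" using that h by (simp add: nth_append)
    then show ?thesis using q that(1) unfolding queue_def by blast
  qed
  moreover have "(qs @ [w]) ! 0 = 0" using q by (simp add: queue_def nth_append)
  ultimately show ?thesis
    using q w0 w unfolding queue_def by (simp del: fun_upd_apply) auto
qed

lemma state_mem_append:
  assumes "w < n" "w \<noteq> 0" "w \<notin> set qs" "length qs < n" "v < n"
  shows "(state_mem qs par)(L + w := Suc v, L + n + length qs := w, L + n + n + v := Suc 0) =
    state_mem (qs @ [w]) (par(w := v))"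
proof -
  have 1: "(\<lambda>u. if u \<in> set qs then if u = 0 then n + 1 else par u + 1 else 0)(w := Suc v) =
      (\<lambda>u. if u \<in> set (qs @ [w]) then if u = 0 then n + 1 else (par(w := v)) u + 1 else 0)"
    using assms by (auto simp: fun_eq_iff)
  have 2: "(\<lambda>l. if l < length qs then qs ! l else 0)(length qs := w) =
      (\<lambda>l. if l < length (qs @ [w]) then (qs @ [w]) ! l else 0)"
    by (auto simp: fun_eq_iff nth_append)
  have 3: "(\<lambda>u. if \<exists>x \<in> set qs. x \<noteq> 0 \<and> par x = u then 1 else 0)(v := Suc 0) =
      (\<lambda>u. if \<exists>x \<in> set (qs @ [w]). x \<noteq> 0 \<and> (par(w := v)) x = u then 1 else 0)"
    using assms by (auto simp: fun_eq_iff)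
  show ?thesis
    unfolding state_mem_def mem_update[OF assms(1)] mem_update[OF assms(4)] mem_update[OF assms(5)] 1 2 3 ..
qed

lemma state_mem_read:
  assumes "v < n"
  shows "state_mem qs par (L + v) = (if v \<in> set qs then if v = 0 then n + 1 else par v + 1 else 0)"
    "state_mem qs par (L + n + v) = (if v < length qs then qs ! v else 0)"
    "state_mem qs par (L + n + n + v) = (if \<exists>w \<in> set qs. w \<noteq> 0 \<and> par w = v then 1 else 0)"
  using assms by (simp_all add: state_mem_def)

lemma state_mem_inp: "x < L \<Longrightarrow> state_mem qs par x = inp ! x"
  by (simp add: state_mem_def)

lemma queue_par_less:
  assumes q: "queue qs par h k" and w: "w \<in> set qs"
  shows "par w < n"
proof -
  obtain l where l: "l < length qs" "w = qs ! l" using w by (auto simp: in_set_conv_nth)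
  show ?thesis
  proof (cases "l = 0")
    case True
    then show ?thesis using q l n_pos by (simp add: queue_def)
  next
    case False
    then obtain i where "i < l" "par w = qs ! i" using q l unfolding queue_def by blast
    then show ?thesis using queue_less[OF q, of "qs ! i"] l by simp
  qed
qed

lemma set_take_Suc: "j < length xs \<Longrightarrow> set (take (Suc j) xs) = insert (xs ! j) (set (take j xs))"
  by (simp add: take_Suc_conv_app_nth)

text \<open>\<open>K\<close> is the time reserved for what follows, and 20 steps pay for one list
  entry in either case. The unchanged prefix of the queue keeps the accounting of the outer loop
  valid.\<close>

lemma search_list_wp:
  assumes R: "base R" "R 6 = h" "R 7 = length qs" "R 8 = v" "R 9 = off v" "R 10 = off v + length (adj ! v)"
    and q: "queue qs par h (Suc h)" "h < length qs" "qs ! h = v"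
    and T: "20 * length (adj ! v) + 1 + K \<le> T"
    and post: "\<And>R qs' par T. base R \<Longrightarrow> R 6 = h \<Longrightarrow> R 7 = length qs' \<Longrightarrow> queue qs' par (Suc h) (Suc h) \<Longrightarrow>
      h < length qs' \<Longrightarrow> take (Suc h) qs' = take (Suc h) qs \<Longrightarrow> K \<le> T \<Longrightarrow> Q (R, state_mem qs' par) T"
  shows "wp W search_list Q (R, state_mem qs par) T"
  unfolding search_list_def
proof (rule wp_Loop)
  let ?d = "length (adj ! v)"
  define I where "I = (\<lambda>(R, M) T. \<exists>qs' par j. M = state_mem qs' par \<and> base R \<and> R 6 = h \<and>
    R 7 = length qs' \<and> R 8 = v \<and> R 9 = off v + j \<and> R 10 = off v + ?d \<and> j \<le> ?d \<and>
    queue qs' par h (Suc h) \<and> h < length qs' \<and> qs' ! h = v \<and> take (Suc h) qs' = take (Suc h) qs \<and>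
    set (take j (adj ! v)) \<subseteq> set qs' \<and> 20 * (?d - j) + 1 + K \<le> T)"
  show "I (R, state_mem qs par) T"
    unfolding I_def using R q T by (auto intro!: exI[of _ qs] exI[of _ par] exI[of _ 0])
  have v: "v < n" using queue_less[OF q(1), of v] q(2,3) by auto
  have I_intro: "I (R, state_mem qs' par) T" if "base R" "R 6 = h" "R 7 = length qs'" "R 8 = v"
    "R 9 = off v + j" "R 10 = off v + ?d" "j \<le> ?d"
    "queue qs' par h (Suc h)" "h < length qs'" "qs' ! h = v" "take (Suc h) qs' = take (Suc h) qs"
    "set (take j (adj ! v)) \<subseteq> set qs'" "20 * (?d - j) + 1 + K \<le> T" for R qs' par j T
    unfolding I_def using that by blast
  fix s T assume I: "I s T"
  then obtain R qs' par j where s: "s = (R, state_mem qs' par)" and R: "base R" "R 6 = h"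
    "R 7 = length qs'" "R 8 = v" "R 9 = off v + j" "R 10 = off v + ?d" "j \<le> ?d"
    and q': "queue qs' par h (Suc h)" "h < length qs'" "qs' ! h = v" "take (Suc h) qs' = take (Suc h) qs"
    and sub: "set (take j (adj ! v)) \<subseteq> set qs'" and T: "20 * (?d - j) + 1 + K \<le> T"
    unfolding I_def by (cases s) auto
  show "1 \<le> T \<and> Q s (T - 1)" if "\<not> test_val (fst s) (Less (Reg 9) (Reg 10))"
  proof -
    have j: "j = ?d" using that s R by simp
    then have "set (adj ! v) \<subseteq> set qs'" using sub by simp
    then have "queue qs' par (Suc h) (Suc h)"
      using q' set_adj[OF v] unfolding queue_def by (auto simp: less_Suc_eq)
    then show ?thesis using post[of R qs' par "T - 1"] R q' T s by auto
  qed
  show "1 \<le> T \<and> wp W (seqs [next_neighbour, Branch (Equal (Reg 13) (Imm 0)) discover Skip]) I s (T - 1)"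
    if "test_val (fst s) (Less (Reg 9) (Reg 10))"
  proof -
    have j: "j < ?d" using that s R by simp
    define w where "w = adj ! v ! j"
    have w: "w < n" "{v, w} \<in> E" using adj_less[OF v j] nth_mem[OF j] set_adj[OF v] by (auto simp: w_def)
    have o: "off v + j < L" "state_mem qs' par (off v + j) = w"
      using off_less[OF v j] inp_adj[OF v j] by (simp_all add: state_mem_inp w_def)
    have T': "20 * (?d - Suc j) + 21 + K \<le> T" using T j by simp
    have sub': "set (take (Suc j) (adj ! v)) = insert w (set (take j (adj ! v)))"
      using set_take_Suc[OF j] by (simp add: w_def)
    show ?thesis
    proof (cases "w \<in> set qs'")
      case True
      have A: "state_mem qs' par (L + w) < W" "state_mem qs' par (L + w) \<noteq> 0"
        using state_mem_read(1)[OF w(1)] True queue_par_less[OF q'(1) True] bounds by auto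
      show ?thesis
        using R(1) T' A
        by (simp add: s next_neighbour_def wp_simps R base_def o)
          (intro conjI I_intro[where j = "Suc j"]; use o w bounds q' sub True j in \<open>simp add: base_def R sub'\<close>)
    next
      case False
      have w0: "w \<noteq> 0" using queue_0[OF q'(1)] False by metis
      have A: "state_mem qs' par (L + w) = 0" using state_mem_read(1)[OF w(1)] False by auto
      have len: "length qs' < n" using queue_length[OF q'(1) w(1) False] .
      have q'': "queue (qs' @ [w]) (par(w := v)) h (Suc h)"
        using queue_append[OF q'(1,2) False] w(2) q'(3) by simp
      show ?thesis
        using R(1) T' A
        by (simp add: s next_neighbour_def discover_def wp_simps R base_def o state_mem_append[OF w(1) w0 False len v])
          (intro conjI I_intro[where j = "Suc j"]; use o w bounds len v q' q'' sub j in \<open>simp add: base_def R sub' nth_append subset_insertI2\<close>)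
    qed
  qed
qed

lemma search_wp:
  assumes R: "base R" "R 6 = 0" "R 7 = 1"
    and T: "(\<Sum>v<n. 20 * length (adj ! v) + 30) + 1 + K \<le> T"
    and post: "\<And>R qs par T. base R \<Longrightarrow> queue qs par (length qs) (length qs) \<Longrightarrow> K \<le> T \<Longrightarrow>
      Q (R, state_mem qs par) T"
  shows "wp W search Q (R, state_mem [0] (\<lambda>_. 0)) T"
  unfolding search_def
proof (rule wp_Loop)
  let ?c = "\<lambda>v. 20 * length (adj ! v) + 30"
  \<comment> \<open>The order of processing is not known in advance, so the remaining budget is a
    sum over the vertices not yet processed.\<close>
  define I where "I = (\<lambda>(R, M) T. \<exists>qs par h. M = state_mem qs par \<and> base R \<and> R 6 = h \<and>
    R 7 = length qs \<and> h \<le> length qs \<and> queue qs par h h \<and>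
    (\<Sum>v\<in>{..<n} - set (take h qs). ?c v) + 1 + K \<le> T)"
  have I_intro: "I (R, state_mem qs par) T" if "base R" "R 6 = h" "R 7 = length qs" "h \<le> length qs"
    "queue qs par h h" "(\<Sum>v\<in>{..<n} - set (take h qs). ?c v) + 1 + K \<le> T" for R qs par h T
    unfolding I_def using that by blast
  have "queue [0] (\<lambda>_. 0) 0 0" using n_pos by (simp add: queue_def)
  then show "I (R, state_mem [0] (\<lambda>_. 0)) T"
    using R T by (intro I_intro[where h = 0]) (simp_all add: lessThan_def[symmetric])
  fix s T assume I: "I s T"
  then obtain R qs par h where s: "s = (R, state_mem qs par)" and R: "base R" "R 6 = h"
    "R 7 = length qs" "h \<le> length qs" and q: "queue qs par h h"
    and T: "(\<Sum>v\<in>{..<n} - set (take h qs). ?c v) + 1 + K \<le> T"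
    unfolding I_def by (cases s) auto
  show "1 \<le> T \<and> Q s (T - 1)" if "\<not> test_val (fst s) (Less (Reg 6) (Reg 7))"
  proof -
    have "h = length qs" using that R s by simp
    then show ?thesis using post[of R qs par "T - 1"] R q T s by simp
  qed
  show "1 \<le> T \<and> wp W (seqs
    [Add 8 (Reg 3) (Reg 6), Load 8 (Reg 8), Add 9 (Reg 8) (Imm 2), Load 9 (Reg 9),
     Add 10 (Reg 8) (Imm 3), Load 10 (Reg 10), search_list, Add 6 (Reg 6) (Imm 1)]) I s (T - 1)"
    if "test_val (fst s) (Less (Reg 6) (Reg 7))"
  proof -
    have h: "h < length qs" using that s R by simp
    define v where "v = qs ! h"
    have v: "v < n" using queue_less[OF q, of v] h by (simp add: v_def)
    have hn: "h < n" using h queue_length_le[OF q] by simp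
    define rest where "rest = (\<Sum>v\<in>{..<n} - set (take (Suc h) qs). ?c v)"
    have "v \<in> {..<n} - set (take h qs)"
      using v q h by (auto simp: v_def queue_def in_set_conv_nth nth_eq_iff_index_eq)
    moreover have "{..<n} - set (take (Suc h) qs) = ({..<n} - set (take h qs)) - {v}"
      using set_take_Suc[OF h] by (auto simp: v_def)
    ultimately have "(\<Sum>v\<in>{..<n} - set (take h qs). ?c v) = ?c v + rest"
      unfolding rest_def by (simp add: sum.remove)
    then have T': "20 * length (adj ! v) + rest + 31 + K \<le> T" using T by simp
    \<comment> \<open>During its own iteration the vertex at position \<open>h\<close> may already
      be a parent, but its neighbours need not all be queued yet; hence the two different
      bounds.\<close>
    have q': "queue qs par h (Suc h)" using q unfolding queue_def by (meson less_SucI)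
    have M: "state_mem qs par (L + n + h) = v" "state_mem qs par (v + 2) = off v"
        "state_mem qs par (v + 3) = off v + length (adj ! v)"
      using state_mem_read(2)[OF hn] h inp_off[of v] inp_off3[OF v] v bounds
      by (simp_all add: state_mem_inp v_def)
    have ov: "off v + length (adj ! v) \<le> L" using off_Suc[OF v] off_le[of "Suc v"] v by simp
    have list: "wp W search_list (wp W (seqs [Add 6 (Reg 6) (Imm 1)]) I) (R', state_mem qs par) T''"
      if R': "base R'" "R' 6 = h" "R' 7 = length qs" "R' 8 = v" "R' 9 = off v" "R' 10 = off v + length (adj ! v)"
        and T'': "20 * length (adj ! v) + 1 + (rest + 10 + K) \<le> T''" for R' T''
    proof (rule search_list_wp[OF R' q' h _ T''])
      show "qs ! h = v" by (simp add: v_def)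
      fix R'' qs' par' T3
      assume *: "base R''" "R'' 6 = h" "R'' 7 = length qs'" "queue qs' par' (Suc h) (Suc h)"
        "h < length qs'" "take (Suc h) qs' = take (Suc h) qs" "rest + 10 + K \<le> T3"
      then show "wp W (seqs [Add 6 (Reg 6) (Imm 1)]) I (R'', state_mem qs' par') T3"
        using hn bounds
        by (simp add: wp_simps)
          (intro conjI I_intro[where h = "Suc h"]; simp add: base_def rest_def)
    qed
    show ?thesis
      using R(1) T' v hn ov bounds
      by (simp add: s wp_simps R base_def M M(2)[unfolded add_2_eq_Suc'])
        (intro conjI list[unfolded seqs.simps One_nat_def]; simp add: base_def R)
  qed
qed

end

section \<open>The finished search as a tree of cliques\<close>

locale searched = graph_input +
  fixes qs :: "nat list" and par :: "nat \<Rightarrow> nat"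
  assumes queue: "queue qs par (length qs) (length qs)"
begin

text \<open>A finished queue contains 0 and is closed under neighbours, so connectivity puts every
  vertex into it.\<close>

lemma set_queue: "set qs = {..<n}"
proof
  show "set qs \<subseteq> {..<n}" using queue by (simp add: queue_def)
  have closed: "w \<in> set qs" if "u \<in> set qs" "{u, w} \<in> E" for u w
    using that queue unfolding queue_def by (metis in_set_conv_nth)
  show "{..<n} \<subseteq> set qs"
  proof
    fix v assume "v \<in> {..<n}"
    then obtain p where "path_between {..<n} E 0 v p"
      using conn n_pos unfolding connected_graph_def by (metis lessThan_iff)
    then have p: "successively (\<lambda>x y. {x, y} \<in> E) p" "hd p = 0" "last p = v" "p \<noteq> []"
      by (auto simp: path_between_def)
    have "set p \<subseteq> set qs" if "successively (\<lambda>x y. {x, y} \<in> E) p" "p \<noteq> []" "hd p \<in> set qs" for p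
      using that closed by (induction p rule: induct_list012) auto
    then have "set p \<subseteq> set qs" using p queue_0[OF queue] by simp
    then show "v \<in> set qs" using p(3,4) last_in_set by blast
  qed
qed

lemma length_queue: "length qs = n"
  using queue set_queue distinct_card[of qs] by (simp add: queue_def)

definition pos :: "nat \<Rightarrow> nat" where
  "pos v = the_inv_into {..<n} ((!) qs) v"

lemma pos_nth: "i < n \<Longrightarrow> pos (qs ! i) = i"
  unfolding pos_def using queue length_queue
  by (intro the_inv_into_f_f) (auto simp: queue_def inj_on_nth)

lemma nth_pos: "v < n \<Longrightarrow> \<exists>i<n. v = qs ! i"
  using set_queue length_queue by (metis in_set_conv_nth lessThan_iff)

lemma par_nth:
  assumes "v < n" "v \<noteq> 0"
  shows "\<exists>l<n. \<exists>i<l. v = qs ! l \<and> par v = qs ! i \<and> {v, qs ! i} \<in> E \<and> (\<forall>j<i. {v, qs ! j} \<notin> E)"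
proof -
  obtain l where l: "l < n" "v = qs ! l" using nth_pos assms by blast
  moreover have "0 < l" using l assms(2) queue by (cases l) (auto simp: queue_def)
  ultimately show ?thesis using queue length_queue unfolding queue_def by metis
qed

lemma search_order: "search_order {..<n} E 0 par pos"
proof
  show "block_graph {..<n} E" by (fact bg)
  show "0 \<in> {..<n}" using n_pos by simp
  show "par 0 = 0" using queue by (simp add: queue_def)
  show "inj_on pos {..<n}"
  proof (rule inj_onI)
    fix u v assume "u \<in> {..<n}" "v \<in> {..<n}" "pos u = pos v"
    then show "u = v" using nth_pos[of u] nth_pos[of v] pos_nth by fastforce
  qed
  show "par v \<in> {..<n} \<and> {v, par v} \<in> E \<and> pos (par v) < pos v" if v: "v \<in> {..<n}" "v \<noteq> 0" for v
  proof -
    obtain l i where "l < n" "i < l" "v = qs ! l" "par v = qs ! i" "{v, qs ! i} \<in> E"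
      using par_nth[of v] v by auto
    then show ?thesis using pos_nth[of l] pos_nth[of i] edgeD[of v "qs ! i"] by simp
  qed
  show "pos (par v) \<le> pos a" if va: "{v, a} \<in> E" "v \<noteq> 0" for v a
  proof -
    obtain l i where i: "l < n" "i < l" "par v = qs ! i" "\<forall>j<i. {v, qs ! j} \<notin> E"
      using par_nth[of v] va edgeD[of v a] by auto
    obtain k where "k < n" "a = qs ! k" using nth_pos[of a] edgeD[of v a] va by auto
    moreover from this have "\<not> k < i" using i va by auto
    ultimately show ?thesis using pos_nth[of i] pos_nth[of k] i by simp
  qed
qed

sublocale T: ordered_clique_tree "{..<n}" E 0 par pos
proof -
  interpret search_order "{..<n}" E 0 par pos by (rule search_order)
  show "ordered_clique_tree {..<n} E 0 par pos" by unfold_locales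
qed

section \<open>Counting the classes from the adjacency lists\<close>

abbreviation M :: "nat \<Rightarrow> nat" where
  "M \<equiv> state_mem qs par"

lemma M_parent: "v < n \<Longrightarrow> M (L + v) = (if v = 0 then n + 1 else par v + 1)"
  using state_mem_read(1)[of v qs par] set_queue by simp

lemma M_child: "v < n \<Longrightarrow> M (L + n + n + v) = (if T.has_child v then 1 else 0)"
  using state_mem_read(3)[of v qs par] set_queue by (auto simp: T.has_child_def)

lemma par_less: "v < n \<Longrightarrow> par v < n"
  using T.par_V[of v] by simp

text \<open>The part of the class of \<open>v\<close> seen after \<open>j\<close> list entries. The
  root is excluded explicitly because \<open>par 0 = 0\<close> agrees with the parent of its
  children.\<close>

definition siblings :: "nat \<Rightarrow> nat \<Rightarrow> nat set" where
  "siblings v j = insert v {w \<in> set (take j (adj ! v)). w \<noteq> 0 \<and> par w = par v}"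

lemma siblings_all:
  assumes "v < n" "v \<noteq> 0"
  shows "siblings v (length (adj ! v)) = T.cls v"
  using assms set_adj[OF assms(1)] edgeD by (auto simp: siblings_def T.cls_def insert_commute)

lemma siblings_Suc:
  "j < length (adj ! v) \<Longrightarrow> siblings v (Suc j) =
    (let w = adj ! v ! j in if w \<noteq> 0 \<and> par w = par v then insert w (siblings v j) else siblings v j)"
  by (auto simp: siblings_def set_take_Suc Let_def)

text \<open>Keeps the counter exact: no sibling is met twice, and \<open>v\<close> itself is counted
  at the start.\<close>

lemma next_notin_siblings:
  assumes "v < n" "j < length (adj ! v)"
  shows "adj ! v ! j \<notin> siblings v j"
proof -
  have "adj ! v ! j \<notin> set (take j (adj ! v))"
    using distinct_adj[OF assms(1)] assms(2)
    by (auto simp: in_set_conv_nth nth_eq_iff_index_eq)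
  moreover have "{v, adj ! v ! j} \<in> E" using set_adj[OF assms(1)] nth_mem[OF assms(2)] by auto
  then have "adj ! v ! j \<noteq> v" using T.edgeD by metis
  ultimately show ?thesis by (simp add: siblings_def)
qed

lemma count_list_wp:
  assumes v: "v < n" "v \<noteq> 0"
    and R: "base R" "R 6 = v" "R 8 = par v + 1" "R 9 = off v" "R 10 = off v + length (adj ! v)"
      "R 14 = (if T.has_child v then 1 else 0)" "R 17 = 1"
    and T: "20 * length (adj ! v) + 1 + K \<le> T"
    and post: "\<And>R' T. base R' \<Longrightarrow> R' 6 = v \<Longrightarrow> R' 8 = par v + 1 \<Longrightarrow> R' 14 = T.cut_count v \<Longrightarrow>
      R' 17 = (if T.leader v then 1 else 0) \<Longrightarrow> R' 0 = R 0 \<Longrightarrow> R' 15 = R 15 \<Longrightarrow> R' 16 = R 16 \<Longrightarrow>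
      K \<le> T \<Longrightarrow> Q (R', M) T"
  shows "wp W count_list Q (R, M) T"
  unfolding count_list_def
proof (rule wp_Loop)
  let ?d = "length (adj ! v)"
  let ?S = "siblings v"
  define I where "I = (\<lambda>(R', M') T. \<exists>j. M' = M \<and> base R' \<and> R' 6 = v \<and> R' 8 = par v + 1 \<and>
    R' 9 = off v + j \<and> R' 10 = off v + ?d \<and> j \<le> ?d \<and> R' 14 = card {s \<in> ?S j. T.has_child s} \<and>
    R' 17 = (if \<forall>s \<in> ?S j. v \<le> s then 1 else 0) \<and> R' 0 = R 0 \<and> R' 15 = R 15 \<and> R' 16 = R 16 \<and>
    20 * (?d - j) + 1 + K \<le> T)"
  have I_intro: "I (R', M) T" if "base R'" "R' 6 = v" "R' 8 = par v + 1"
    "R' 9 = off v + j" "R' 10 = off v + ?d" "j \<le> ?d" "R' 14 = card {s \<in> ?S j. T.has_child s}"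
    "R' 17 = (if \<forall>s \<in> ?S j. v \<le> s then 1 else 0)" "R' 0 = R 0" "R' 15 = R 15" "R' 16 = R 16"
    "20 * (?d - j) + 1 + K \<le> T" for R' j T
    unfolding I_def using that by blast
  have "?S 0 = {v}" by (simp add: siblings_def)
  then have "{s \<in> ?S 0. T.has_child s} = (if T.has_child v then {v} else {})" by auto
  then have "card {s \<in> ?S 0. T.has_child s} = (if T.has_child v then 1 else 0)" by simp
  then show "I (R, M) T"
    using R T \<open>?S 0 = {v}\<close> by (intro I_intro[where j = 0]) simp_all
  fix s T assume I: "I s T"
  then obtain R' j where s: "s = (R', M)" and R': "base R'" "R' 6 = v" "R' 8 = par v + 1"
    "R' 9 = off v + j" "R' 10 = off v + ?d" "j \<le> ?d" "R' 14 = card {s \<in> ?S j. T.has_child s}"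
    "R' 17 = (if \<forall>s \<in> ?S j. v \<le> s then 1 else 0)" "R' 0 = R 0" "R' 15 = R 15" "R' 16 = R 16"
    and T: "20 * (?d - j) + 1 + K \<le> T"
    unfolding I_def by (cases s) auto
  show "1 \<le> T \<and> Q s (T - 1)" if "\<not> test_val (fst s) (Less (Reg 9) (Reg 10))"
  proof -
    have "j = ?d" using that s R' by simp
    then have "?S j = T.cls v" using siblings_all[OF v] by simp
    then show ?thesis
      using post[of R' "T - 1"] R' T s by (simp add: T.cut_count_def T.leader_def)
  qed
  show "1 \<le> T \<and> wp W (seqs [next_neighbour,
     Branch (Equal (Reg 13) (Reg 8))
       (seqs [Add 12 (Reg 4) (Reg 11), Load 12 (Reg 12), Add 14 (Reg 14) (Reg 12),
              Branch (Less (Reg 11) (Reg 6)) (Move 17 (Imm 0)) Skip])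
       Skip]) I s (T - 1)"
    if "test_val (fst s) (Less (Reg 9) (Reg 10))"
  proof -
    have j: "j < ?d" using that s R' by simp
    define w where "w = adj ! v ! j"
    have w: "w < n" using adj_less[OF v(1) j] by (simp add: w_def)
    have o: "off v + j < L" "M (off v + j) = w"
      using off_less[OF v(1) j] inp_adj[OF v(1) j] by (simp_all add: state_mem_inp w_def)
    have T': "20 * (?d - Suc j) + 21 + K \<le> T" using T j by simp
    have wS: "w \<notin> ?S j" using next_notin_siblings[OF v(1) j] by (simp add: w_def)
    have fin: "finite (?S j)" by (simp add: siblings_def)
    \<comment> \<open>The counter must fit into a word; it counts vertices, so \<open>n\<close>
      bounds it.\<close>
    have "card {s \<in> ?S j. T.has_child s} \<le> card {..<n}"
      using v(1) edgeD set_adj[OF v(1)] by (intro card_mono) (auto simp: siblings_def dest!: in_set_takeD)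
    then have card: "card {s \<in> ?S j. T.has_child s} \<le> n" by simp
    have pw: "M (L + w) < W" "M (L + w) = par v + 1 \<longleftrightarrow> w \<noteq> 0 \<and> par w = par v"
      using M_parent[OF w] par_less[OF w] par_less[OF v(1)] bounds by auto
    have cw: "M (L + n + n + w) \<le> 1" "L + n + n + w < W" using M_child[OF w] w bounds by auto
    show ?thesis
    proof (cases "w \<noteq> 0 \<and> par w = par v")
      case True
      have S: "?S (Suc j) = insert w (?S j)" using siblings_Suc[OF j] True by (simp add: w_def Let_def)
      have "{s \<in> ?S (Suc j). T.has_child s} =
          (if T.has_child w then insert w {s \<in> ?S j. T.has_child s} else {s \<in> ?S j. T.has_child s})"
        unfolding S by auto
      then have c: "card {s \<in> ?S (Suc j). T.has_child s} = card {s \<in> ?S j. T.has_child s} + M (L + n + n + w)"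
        using M_child[OF w] wS fin by simp
      have l: "(\<forall>s \<in> ?S (Suc j). v \<le> s) \<longleftrightarrow> (\<forall>s \<in> ?S j. v \<le> s) \<and> \<not> w < v"
        unfolding S by auto
      show ?thesis
        using R'(1) T' pw True
        by (simp add: s next_neighbour_def wp_simps R' base_def o)
          (intro conjI impI I_intro[where j = "Suc j"];
           use o w bounds card cw c l j R'(8) in \<open>simp add: base_def R'(1-7,9-) wp_simps\<close>)
    next
      case False
      have neq: "M (L + w) \<noteq> par v + 1" using pw(2) False by blast
      have S: "?S (Suc j) = ?S j" using siblings_Suc[OF j] False by (auto simp: w_def Let_def)
      show ?thesis
        using R'(1) T' pw(1) neq
        by (simp add: s next_neighbour_def wp_simps R' base_def o)
          (intro conjI I_intro[where j = "Suc j"]; use o w bounds S j in \<open>simp add: base_def R'\<close>)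
    qed
  qed
qed

text \<open>The range starts at 1 because the root belongs to no class.\<close>

definition tally :: "nat \<Rightarrow> (nat \<Rightarrow> bool) \<Rightarrow> nat" where
  "tally v P = card {u \<in> {1..<v}. P u}"

lemma tally_1: "tally 1 P = 0"
  by (simp add: tally_def)

lemma tally_Suc:
  assumes "1 \<le> v"
  shows "tally (Suc v) P = tally v P + (if P v then 1 else 0)"
proof -
  have "{u \<in> {1..<Suc v}. P u} = (if P v then insert v {u \<in> {1..<v}. P u} else {u \<in> {1..<v}. P u})"
    using assms by (auto simp: less_Suc_eq)
  then show ?thesis by (simp add: tally_def)
qed

lemma tally_less:
  assumes "1 \<le> v"
  shows "tally v P < v"
proof -
  have "card {u \<in> {1..<v}. P u} \<le> card {1..<v}" by (intro card_mono) auto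
  then show ?thesis using assms by (simp add: tally_def)
qed

definition "simple_leader u \<longleftrightarrow> T.leader u \<and> T.cut_count u \<le> 1"
definition "root_leader u \<longleftrightarrow> T.leader u \<and> par u = 0"
definition "root_leader2 u \<longleftrightarrow> T.leader u \<and> par u = 0 \<and> T.cut_count u = 2"

lemma count_wp:
  assumes R: "base R" "R 6 = 1" "R 0 = 0" "R 15 = 0" "R 16 = 0"
    and T: "(\<Sum>v=1..<n. 20 * length (adj ! v) + 50) + 1 + K \<le> T"
    and post: "\<And>R T. R 0 = tally n simple_leader \<Longrightarrow>
      R 15 = tally n root_leader \<Longrightarrow> R 16 = tally n root_leader2 \<Longrightarrow>
      K \<le> T \<Longrightarrow> Q (R, M) T"
  shows "wp W count Q (R, M) T"
  unfolding count_def
proof (rule wp_Loop)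
  let ?c = "\<lambda>v. 20 * length (adj ! v) + 50"
  define I where "I = (\<lambda>(R, M') T. \<exists>v. M' = M \<and> base R \<and> R 6 = v \<and> 1 \<le> v \<and> v \<le> n \<and>
    R 0 = tally v simple_leader \<and> R 15 = tally v root_leader \<and> R 16 = tally v root_leader2 \<and>
    (\<Sum>v=v..<n. ?c v) + 1 + K \<le> T)"
  have I_intro: "I (R', M) T'" if "base R'" "R' 6 = k" "1 \<le> k" "k \<le> n"
    "R' 0 = tally k simple_leader" "R' 15 = tally k root_leader" "R' 16 = tally k root_leader2"
    "(\<Sum>v=k..<n. ?c v) + 1 + K \<le> T'" for R' k T'
    unfolding I_def using that by blast
  show "I (R, M) T"
    using R T n_pos by (intro I_intro[of _ 1]) (simp_all add: tally_1[unfolded One_nat_def])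
  fix s T assume I: "I s T"
  then obtain R v where s: "s = (R, M)" and R: "base R" "R 6 = v" "1 \<le> v" "v \<le> n"
    "R 0 = tally v simple_leader" "R 15 = tally v root_leader" "R 16 = tally v root_leader2"
    and T: "(\<Sum>v=v..<n. ?c v) + 1 + K \<le> T"
    unfolding I_def by (cases s) auto
  show "1 \<le> T \<and> Q s (T - 1)" if "\<not> test_val (fst s) (Less (Reg 6) (Reg 1))"
  proof -
    have "v = n" using that R s by (simp add: base_def)
    then show ?thesis using post[of R "T - 1"] R T s by simp
  qed
  let ?tail = "[Branch (Equal (Reg 17) (Imm 1))
       (seqs [Branch (Less (Reg 14) (Imm 2)) (Add 0 (Reg 0) (Imm 1)) Skip,
              Branch (Equal (Reg 8) (Imm 1))
                (seqs [Add 15 (Reg 15) (Imm 1),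
                       Branch (Equal (Reg 14) (Imm 2)) (Add 16 (Reg 16) (Imm 1)) Skip])
                Skip])
       Skip,
     Add 6 (Reg 6) (Imm 1)]"
  show "1 \<le> T \<and> wp W (seqs ([Add 9 (Reg 6) (Imm 2), Load 9 (Reg 9), Add 10 (Reg 6) (Imm 3), Load 10 (Reg 10),
     Add 8 (Reg 2) (Reg 6), Load 8 (Reg 8), Add 12 (Reg 4) (Reg 6), Load 14 (Reg 12),
     Move 17 (Imm 1), count_list,
     Branch (Equal (Reg 17) (Imm 1))
       (seqs [Branch (Less (Reg 14) (Imm 2)) (Add 0 (Reg 0) (Imm 1)) Skip,
              Branch (Equal (Reg 8) (Imm 1))
                (seqs [Add 15 (Reg 15) (Imm 1),
                       Branch (Equal (Reg 14) (Imm 2)) (Add 16 (Reg 16) (Imm 1)) Skip])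
                Skip])
       Skip,
     Add 6 (Reg 6) (Imm 1)])) I s (T - 1)"
    if "test_val (fst s) (Less (Reg 6) (Reg 1))"
  proof -
    have vn: "v < n" using that s R by (simp add: base_def)
    have v: "v < n" "v \<noteq> 0" using vn R by auto
    define rest where "rest = (\<Sum>v=Suc v..<n. ?c v)"
    have "(\<Sum>v=v..<n. ?c v) = ?c v + rest"
      unfolding rest_def by (rule sum.atLeast_Suc_lessThan[OF vn])
    then have T': "20 * length (adj ! v) + rest + 51 + K \<le> T" using T by simp
    have Mv: "M (v + 2) = off v" "M (v + 3) = off v + length (adj ! v)" "M (L + v) = par v + 1"
        "M (L + n + n + v) = (if T.has_child v then 1 else 0)"
      using inp_off[of v] inp_off3[OF vn] vn bounds M_parent[OF vn] M_child[OF vn] v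
      by (simp_all add: state_mem_inp)
    have ov: "off v + length (adj ! v) \<le> L" using off_Suc[OF vn] off_le[of "Suc v"] vn by simp
    have bnd: "tally v P + 1 < W" for P using tally_less[of v P] R vn bounds by linarith
    have list: "wp W count_list (wp W (seqs ?tail) I) (R', M) T''"
      if R': "base R'" "R' 6 = v" "R' 8 = par v + 1" "R' 9 = off v" "R' 10 = off v + length (adj ! v)"
        "R' 14 = (if T.has_child v then 1 else 0)" "R' 17 = 1"
        and keep: "R' 0 = R 0" "R' 15 = R 15" "R' 16 = R 16"
        and T'': "20 * length (adj ! v) + 1 + (rest + 20 + K) \<le> T''" for R' T''
    proof (rule count_list_wp[OF v R' T''])
      fix R'' T3
      assume *: "base R''" "R'' 6 = v" "R'' 8 = par v + 1" "R'' 14 = T.cut_count v"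
        "R'' 17 = (if T.leader v then 1 else 0)" "R'' 0 = R' 0" "R'' 15 = R' 15" "R'' 16 = R' 16"
        "rest + 20 + K \<le> T3"
      have cnt: "tally (Suc v) P = tally v P + (if P v then 1 else 0)" for P
        using tally_Suc[of v P] R by simp
      note b = bnd[of simple_leader] bnd[of root_leader] bnd[of root_leader2]
      show "wp W (seqs ?tail) I (R'', M) T3"
        \<comment> \<open>One case for each outcome of the tests in \<open>?tail\<close>; in each,
          the registers end up as the tallies for \<open>Suc v\<close>.\<close>
        by (cases "T.leader v"; cases "par v = 0"; cases "T.cut_count v < 2"; cases "T.cut_count v = 2";
            simp add: wp_simps keep R(5-7) *(2-8);
            intro conjI I_intro[of _ "Suc v"];
            use *(1,9) b vn bounds in \<open>simp add: base_def rest_def cnt keep R(5-7) *(2-8)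
                simple_leader_def root_leader_def root_leader2_def\<close>)
    qed
    show ?thesis
      using R(1) T' vn ov bounds par_less[OF vn]
      by (simp add: s wp_simps R(2) base_def Mv Mv(1)[unfolded add_2_eq_Suc'])
        (intro conjI impI list[unfolded seqs.simps One_nat_def]; simp add: base_def R(2))
  qed
qed

end

section \<open>Correctness and running time of the whole program\<close>

lemma (in searched) src_eq:
  "strong_rainbow_connection_number {..<n} E =
    tally n simple_leader + (if tally n root_leader = 1 then tally n root_leader2 else 0)"
proof -
  have "{v \<in> {..<n} - {0}. P v} = {u \<in> {1..<n}. P u}" for P :: "nat \<Rightarrow> bool" by auto
  then show ?thesis
    unfolding T.strong_rainbow_connection_number_eq[OF conn] T.card_good_classes_leaders
    by (simp add: tally_def simple_leader_def root_leader_def root_leader2_def)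
qed

context graph_input begin

text \<open>A single store initialises the search: the root is vertex 0, so zeroed memory already
  represents the queue \<open>[0]\<close>, with all other vertices undiscovered and no flags
  set.\<close>

lemma input_mem:
  "(\<lambda>i. if i < length inp then inp ! i else 0)(L := Suc n) = state_mem [0] (\<lambda>_. 0)"
  using n_pos by (auto simp: state_mem_def mem_def length_inp fun_eq_iff)

lemma src_prog_wp:
  assumes T: "(\<Sum>v<n. 20 * length (adj ! v) + 30) + (\<Sum>v=1..<n. 20 * length (adj ! v) + 50) + 40 \<le> T"
  shows "wp W src_prog (\<lambda>s _. output_value s = strong_rainbow_connection_number {..<n} E) (input_state inp) T"
proof -
  let ?Q = "\<lambda>s _. output_value s = strong_rainbow_connection_number {..<n} E"
  let ?S1 = "\<Sum>v<n. 20 * length (adj ! v) + 30" and ?S2 = "\<Sum>v=1..<n. 20 * length (adj ! v) + 50"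
  let ?rest2 = "[Branch (Equal (Reg 15) (Imm 1)) (Add 0 (Reg 0) (Reg 16)) Skip]"
  let ?rest1 = "[Move 6 (Imm 1), Move 0 (Imm 0), Move 15 (Imm 0), Move 16 (Imm 0), count] @ ?rest2"
  have count: "wp W count (wp W (seqs ?rest2) ?Q) (R, state_mem qs par) T'"
    if q: "queue qs par (length qs) (length qs)" and R: "base R" "R 6 = 1" "R 0 = 0" "R 15 = 0" "R 16 = 0"
      and T': "?S2 + 1 + 10 \<le> T'" for R qs par T'
  proof -
    interpret searched n E adj W qs par by unfold_locales (rule q)
    show ?thesis
    proof (rule count_wp[OF R T'])
      fix R :: "nat \<Rightarrow> nat" and T :: nat
      assume R: "R 0 = tally n simple_leader" "R 15 = tally n root_leader" "R 16 = tally n root_leader2"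
        and T: "10 \<le> T"
      have "tally n simple_leader < n" "tally n root_leader2 < n"
        using tally_less[of n] n_pos by auto
      then show "wp W (seqs ?rest2) ?Q (R, M) T"
        using T bounds by (simp add: wp_simps R output_value_def src_eq) (intro conjI; simp)
    qed
  qed
  have search: "wp W search (wp W (seqs ?rest1) ?Q) (R, state_mem [0] (\<lambda>_. 0)) T'"
    if R: "base R" "R 6 = 0" "R 7 = 1" and T': "?S1 + 1 + (?S2 + 20) \<le> T'" for R T'
  proof (rule search_wp[OF R T'])
    fix R :: "nat \<Rightarrow> nat" and qs par and T :: nat
    assume R: "base R" and q: "queue qs par (length qs) (length qs)" and T: "?S2 + 20 \<le> T"
    show "wp W (seqs ?rest1) ?Q (R, state_mem qs par) T"
      using T bounds
      by (simp add: wp_simps)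
        (intro conjI count[unfolded seqs.simps One_nat_def, OF q]; use R in \<open>simp add: base_def\<close>)
  qed
  have inp: "inp ! 0 = n" "inp ! Suc (Suc n) = L" "inp \<noteq> []" "Suc (Suc n) < length inp"
    using inp_0 inp_L bounds length_inp by auto
  show ?thesis
    using T bounds
    by (simp add: src_prog_def init_prog_def input_state_def wp_simps inp input_mem)
      (intro conjI search[unfolded append.simps seqs.simps One_nat_def]; simp add: base_def)
qed

end

theorem corollary9:
  "\<exists>(P :: program) (C :: nat) (k :: nat). \<forall>(n :: nat) (E :: nat set set) (adj :: nat list list).
     connected_graph {..<n} E \<and> block_graph {..<n} E \<and> adjacency_lists n E adj \<longrightarrow>
     (\<exists>t s. ram_exec ((n + card E + 1) ^ k) P (input_state (graph_encoding n (card E) adj)) t s \<and>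
        output_value s = strong_rainbow_connection_number {..<n} E \<and>
        t \<le> C * (n + card E))"
proof (rule exI[of _ src_prog], rule exI[of _ 120], rule exI[of _ 4], intro allI impI, elim conjE)
  fix n :: nat and E :: "nat set set" and adj :: "nat list list"
  assume conn: "connected_graph {..<n} E" and bg: "block_graph {..<n} E" and adj: "adjacency_lists n E adj"
  define X where "X = n + card E + 1"
  have n: "0 < n" using conn by (auto simp: connected_graph_def)
  then have "2 \<le> X" by (simp add: X_def)
  \<comment> \<open>The exponent 4 is forced by the smallest graph: for one vertex the base is 2,
    and \<open>W\<close> has to exceed 9.\<close>
  then have "2 ^ 3 * X \<le> X ^ 3 * X" by (intro mult_right_mono power_mono) auto
  then have "8 * X \<le> X ^ 4" by (simp add: eval_nat_numeral mult.assoc)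
  then have W: "4 * n + 2 * card E + 5 < (n + card E + 1) ^ 4"
    using n by (simp add: X_def)
  interpret graph_input n E adj "(n + card E + 1) ^ 4"
    by unfold_locales (fact bg conn adj W)+
  have sum: "(\<Sum>v<n. length (adj ! v)) \<le> 2 * card E"
    using length_concat_le length_concat by simp
  have "(\<Sum>v=1..<n. 20 * length (adj ! v) + 50) \<le> (\<Sum>v<n. 20 * length (adj ! v) + 50)"
    by (rule sum_mono2) auto
  also have "\<dots> = 20 * (\<Sum>v<n. length (adj ! v)) + 50 * n"
    by (simp add: sum.distrib sum_distrib_left)
  finally have "(\<Sum>v=1..<n. 20 * length (adj ! v) + 50) \<le> 40 * card E + 50 * n" using sum by simp
  moreover have "(\<Sum>v<n. 20 * length (adj ! v) + 30) \<le> 40 * card E + 30 * n"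
    using sum by (simp add: sum.distrib sum_distrib_left[symmetric])
  \<comment> \<open>Since \<open>n\<close> is positive, the additive 40 is at most
    \<open>40 * n\<close>. Vertices then cost 30 + 50 + 40 = 120 each, and edges 80.\<close>
  ultimately have "(\<Sum>v<n. 20 * length (adj ! v) + 30) + (\<Sum>v=1..<n. 20 * length (adj ! v) + 50) + 40
      \<le> 120 * (n + card E)"
    using n by simp
  from src_prog_wp[OF this]
  show "\<exists>t s. ram_exec ((n + card E + 1) ^ 4) src_prog (input_state (graph_encoding n (card E) adj)) t s \<and>
      output_value s = strong_rainbow_connection_number {..<n} E \<and> t \<le> 120 * (n + card E)"
    unfolding wp_def inp_def by blast
qed

end
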